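(* Let $T>0$, let $B$, $Y$ be Banach spaces and let $M_+$ be a seminormed nonnegative cone in $B$ (with function $[\cdot]$). Let either $1\le p<\infty$, $r=1$, or $p=\infty$, $r>1$. Let $(u_\tau)\subset L^p(0,T;M_+\cap Y)$ be a sequence of functions, indexed by time steps $\tau=T/N$ with $N\in\mathbb{N}$ (with $\tau\to0$ along the sequence in the case $p=\infty$), such that $u_\tau$ is constant on each subinterval $((k-1)\tau,k\tau]$, $1\le k\le N$, $T=N\tau$. Assume that: (i) $M_+\hookrightarrow B$ compactly. (ii) For all sequences $(w_n)\subset B$: if $w_n\to w$ in $B$ and $w_n\to 0$ in $Y$ as $n\to\infty$, then $w=0$. (iii) $(u_\tau)$ is bounded in $L^p(0,T;M_+)$. (iv) There exists $C>0$ such that for all $\tau$, $\|\sigma_\tau u_\tau-u_\tau\|_{L^r(0,T-\tau;Y)}\le C\tau$. Then, if $p<\infty$, $(u_\tau)$ is relatively compact in $L^p(0,T;B)$; and if $p=\infty$, there exists a subsequence of $(u_\tau)$ converging in $L^q(0,T;B)$ for all $1\le q<\infty$ to a limit function belonging to $C^0([0,T];B)$.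
   Context: Seminormed nonnegative cone: $M_+$ is a seminormed nonnegative cone in a Banach space $B$ if $M_+\subset B$; $cu\in M_+$ for all $u\in M_+$ and $c\ge 0$; and there is a function $[\cdot]:M_+\to[0,\infty)$ such that $[u]=0$ if and only if $u=0$, and $[cu]=c[u]$ for all $c\ge 0$, $u\in M_+$. (No convexity of $M_+$ and no triangle inequality for $[\cdot]$ is assumed.) Embeddings: $M_+\hookrightarrow B$ compactly means that every sequence $(u_n)\subset M_+$ with $\sup_n[u_n]<\infty$ has a subsequence converging in $B$. Conventions: $B$ and $Y$ are regarded as linear subspaces of a common vector space, so that $B\cap Y$ and $M_+\cap Y$ make sense; "$w_n\to 0$ in $Y$" includes $w_n\in Y$. No embedding of $B$ into $Y$ is assumed. $L^p(0,T;M_+)$ is the set of strongly measurable $u:(0,T)\to B$ with $u(t)\in M_+$ for a.e. $t$, $t\mapsto[u(t)]$ measurable, and $\|u\|_{L^p(0,T;M_+)}:=\big\|\,t\mapsto[u(t)]\,\big\|_{L^p(0,T)}<\infty$; bounded means that these quantities are uniformly bounded. $L^p(0,T;M_+\cap Y):=L^p(0,T;M_+)\cap L^p(0,T;Y)$. The time shift is $(\sigma_\tau u)(t)=u(t+\tau)$. *)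

theory Defs
  imports "HOL-Probability.Essential_Supremum"
begin

section \<open>Seminormed nonnegative cones\<close>

definition seminormed_cone :: "'b::real_normed_vector set \<Rightarrow> ('b \<Rightarrow> real) \<Rightarrow> bool" where
  "seminormed_cone M sn \<longleftrightarrow>
     (\<forall>u\<in>M. \<forall>c\<ge>0. c *\<^sub>R u \<in> M) \<and>
     (\<forall>u\<in>M. sn u \<ge> 0) \<and>
     (\<forall>u\<in>M. sn u = 0 \<longleftrightarrow> u = 0) \<and>
     (\<forall>u\<in>M. \<forall>c\<ge>0. sn (c *\<^sub>R u) = c * sn u)"

definition compactly_embedded :: "'b::real_normed_vector set \<Rightarrow> ('b \<Rightarrow> real) \<Rightarrow> bool" where
  "compactly_embedded M sn \<longleftrightarrow>
     (\<forall>u :: nat \<Rightarrow> 'b. (\<forall>n. u n \<in> M) \<and> bdd_above (range (\<lambda>n. sn (u n))) \<longrightarrow>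
        (\<exists>s l. strict_mono s \<and> (\<lambda>n. u (s n)) \<longlonglongrightarrow> l))"


section \<open>Lebesgue--Bochner spaces on an interval $(0,T)$\<close>

text \<open>
  The library's \<open>borel_measurable\<close> is not the right notion of measurability for functions
  with values in a possibly non-separable Banach space.
\<close>

definition strongly_measurable :: "'a measure \<Rightarrow> ('a \<Rightarrow> 'b::real_normed_vector) \<Rightarrow> bool" where
  "strongly_measurable A f \<longleftrightarrow>
     (\<exists>s. (\<forall>i. simple_function A (s i)) \<and> (AE t in A. (\<lambda>i. s i t) \<longlonglongrightarrow> f t))"

text \<open>The scalar $L^p(0,T)$ norm for $1 \le p \le \infty$, as an extended number.\<close>

definition Lp_norm :: "ennreal \<Rightarrow> real \<Rightarrow> (real \<Rightarrow> real) \<Rightarrow> ennreal" where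
  "Lp_norm p T g =
     (if p = \<infinity> then esssup (lebesgue_on {0<..<T}) (\<lambda>t. ennreal \<bar>g t\<bar>)
      else let I = (\<integral>\<^sup>+ t. ennreal (\<bar>g t\<bar> powr enn2real p) \<partial>lebesgue_on {0<..<T})
           in if I = \<infinity> then \<infinity> else ennreal (enn2real I powr (1 / enn2real p)))"

text \<open>
  Functions are total on the reals; only their values on $(0,T)$ matter.
  \<open>Lp_fun\<close> is the set of functions, \<open>Lp_space\<close> the set of their classes modulo equality
  almost everywhere on $(0,T)$.
\<close>

definition Lp_fun :: "ennreal \<Rightarrow> real \<Rightarrow> (real \<Rightarrow> 'b::real_normed_vector) set" where
  "Lp_fun p T =
     {u. strongly_measurable (lebesgue_on {0<..<T}) u \<and> Lp_norm p T (\<lambda>t. norm (u t)) < \<infinity>}"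

definition Lp_class ::
  "ennreal \<Rightarrow> real \<Rightarrow> (real \<Rightarrow> 'b::real_normed_vector) \<Rightarrow> (real \<Rightarrow> 'b) set" where
  "Lp_class p T u = {v \<in> Lp_fun p T. AE t in lebesgue_on {0<..<T}. v t = u t}"

definition Lp_space :: "ennreal \<Rightarrow> real \<Rightarrow> (real \<Rightarrow> 'b::real_normed_vector) set set" where
  "Lp_space p T = Lp_class p T ` Lp_fun p T"

definition Lp_dist ::
  "ennreal \<Rightarrow> real \<Rightarrow> (real \<Rightarrow> 'b::real_normed_vector) set \<Rightarrow> (real \<Rightarrow> 'b) set \<Rightarrow> real" where
  "Lp_dist p T X Y =
     enn2real (Lp_norm p T (\<lambda>t. norm ((SOME u. u \<in> X) t - (SOME v. v \<in> Y) t)))"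

definition Lp_topology ::
  "ennreal \<Rightarrow> real \<Rightarrow> (real \<Rightarrow> 'b::real_normed_vector) set topology" where
  "Lp_topology p T = Metric_space.mtopology (Lp_space p T) (Lp_dist p T)"

definition Lp_relatively_compact ::
  "ennreal \<Rightarrow> real \<Rightarrow> (real \<Rightarrow> 'b::real_normed_vector) set \<Rightarrow> bool" where
  "Lp_relatively_compact p T F \<longleftrightarrow>
     F \<subseteq> Lp_fun p T \<and>
     compactin (Lp_topology p T) (Lp_topology p T closure_of (Lp_class p T ` F))"

definition Lp_converges ::
  "ennreal \<Rightarrow> real \<Rightarrow> (nat \<Rightarrow> real \<Rightarrow> 'b::real_normed_vector) \<Rightarrow> (real \<Rightarrow> 'b) \<Rightarrow> bool" where
  "Lp_converges p T f g \<longleftrightarrow>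
     (\<forall>n. f n \<in> Lp_fun p T) \<and> g \<in> Lp_fun p T \<and>
     limitin (Lp_topology p T) (\<lambda>n. Lp_class p T (f n)) (Lp_class p T g) sequentially"

text \<open>
  The values of \<open>sn\<close> off \<open>M\<close> are irrelevant below: they are met only on a null set, and
  the Lebesgue measure is complete.
\<close>

definition Lp_cone ::
  "ennreal \<Rightarrow> real \<Rightarrow> 'b::real_normed_vector set \<Rightarrow> ('b \<Rightarrow> real) \<Rightarrow> (real \<Rightarrow> 'b) set" where
  "Lp_cone p T M sn =
     {u. strongly_measurable (lebesgue_on {0<..<T}) u \<and>
         (AE t in lebesgue_on {0<..<T}. u t \<in> M) \<and>
         (\<lambda>t. sn (u t)) \<in> borel_measurable (lebesgue_on {0<..<T}) \<and>
         Lp_norm p T (\<lambda>t. sn (u t)) < \<infinity>}"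


section \<open>Two Banach spaces inside a common vector space\<close>

text \<open>
  The Banach spaces \<open>'b\<close> and \<open>'y\<close> are subspaces of the vector space \<open>'v\<close> by means of
  injective linear maps \<open>\<iota>\<close> and \<open>\<kappa>\<close>. An element \<open>x\<close> of \<open>'b\<close> lies in the intersection of
  both iff \<open>in_both \<iota> \<kappa> x\<close>, and \<open>as_other \<iota> \<kappa> x\<close> is then the same vector seen as an element
  of \<open>'y\<close> (an arbitrary value otherwise).
\<close>

definition in_both :: "('b \<Rightarrow> 'v) \<Rightarrow> ('y \<Rightarrow> 'v) \<Rightarrow> 'b \<Rightarrow> bool" where
  "in_both \<iota> \<kappa> x \<longleftrightarrow> \<iota> x \<in> range \<kappa>"

definition as_other :: "('b \<Rightarrow> 'v) \<Rightarrow> ('y \<Rightarrow> 'v) \<Rightarrow> 'b \<Rightarrow> 'y" where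
  "as_other \<iota> \<kappa> x = inv \<kappa> (\<iota> x)"

definition Lp_other ::
  "('b \<Rightarrow> 'v) \<Rightarrow> ('y::real_normed_vector \<Rightarrow> 'v) \<Rightarrow> ennreal \<Rightarrow> real \<Rightarrow> (real \<Rightarrow> 'b) set" where
  "Lp_other \<iota> \<kappa> p T =
     {u. (AE t in lebesgue_on {0<..<T}. in_both \<iota> \<kappa> (u t)) \<and>
         (\<lambda>t. as_other \<iota> \<kappa> (u t)) \<in> Lp_fun p T}"

end

theory Submission
  imports Defs "HOL-Library.Diagonal_Subsequence"
begin

text \<open>
  An Ehrling inequality holds on the cone: for every \<open>\<epsilon> > 0\<close> there is \<open>c\<close> such that
  $\|x-y\|_B \le \varepsilon([x]+[y]) + c\|x-y\|_Y$ for $x,y \in M_+ \cap Y$. Assumption (iv) controls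
  the variation \<open>V\<close> of $u_\tau$ in $Y$: it is at most $C$ if $r = 1$, and has a modulus of
  continuity up to $\tau$ if $r > 1$.

  For $p < \infty$ split $(0,T)$ into intervals of length $h$ and let $x_J$ be a minimiser of
  $[u_\tau(\cdot)]$ on the interval $J$ (it exists because $u_\tau$ takes finitely many values). The
  values $[u_\tau(x_J)]$ are bounded by $(K/h)^{1/p}$, where $K$ bounds $\int[u_\tau]^p$, so a diagonal subsequence converges at all
  $x_J$, and $\|u_\tau(t) - u_\tau(x_J)\|_B \le 2\varepsilon[u_\tau(t)] + c\,\Delta_J V$ on $J$. As
  $\sum_J h(\Delta_J V)^p \le hC^p$, this subsequence is Cauchy in $L^p(0,T;B)$.

  For $p = \infty$ the Ehrling inequality makes the $u_\tau$ equicontinuous up to $\tau$, so that a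
  subsequence converging at the rational times converges everywhere, to a uniformly continuous limit.
\<close>

section \<open>The metric of $L^p(0,T)$\<close>

text \<open>The obstacle is that M_+ is assumed neither convex nor closed under differences, and [.]
  has no triangle inequality. Hence [u(t) - u(s)] makes no sense and time averages, the usual
  approximants, may leave M_+. The Ehrling inequality is therefore stated for pairs with [x] + [y]
  on the right, which positive homogeneity alone can normalise, and the approximants are values of u
  itself. A minimiser is the right sample: its [.] is bounded by an average over J, and on J the
  term [u(x_J)] may be replaced by [u(t)], whose p-th power has a bounded integral. For r = 1 the
  variation in Y may be concentrated in a few jumps, so no equicontinuity in time is available. What
  survives is that the oscillations of V over the intervals J add up to at most C; since p >= 1
  their p-th powers then sum to at most C^p, and the length h makes the integral small uniformly in
  the time step. For p infinite, r > 1 rules out this concentration down to the scale of one step,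
  and the remaining error disappears as the step tends to 0. In both cases Y enters only through the
  scalar function V, and (ii) only through the Ehrling inequality.\<close>

definition powr_nn_integral ::
  "'a measure \<Rightarrow> real \<Rightarrow> ('a \<Rightarrow> 'b::real_normed_vector) \<Rightarrow> ennreal" where
  "powr_nn_integral A p f = (\<integral>\<^sup>+ t. ennreal (norm (f t) powr p) \<partial>A)"

section \<open>Measurability of norms and Minkowski's inequality\<close>

lemma complete_measure_lebesgue_on:
  assumes "S \<in> sets lebesgue"
  shows "complete_measure (lebesgue_on S)"
proof
  fix A B assume "B \<subseteq> A" "A \<in> null_sets (lebesgue_on S)"
  then have "A \<subseteq> S" "A \<in> null_sets lebesgue"
    using null_sets_restrict_space[OF assms] by auto
  then have "B \<in> null_sets (lebesgue_on S)"
    using \<open>B \<subseteq> A\<close> completion.complete2[of B A] null_sets_restrict_space[OF assms] by blast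
  then show "B \<in> sets (lebesgue_on S)"
    by (rule null_setsD2)
qed

lemma borel_measurable_cong_AE:
  fixes f g :: "'a \<Rightarrow> 'b::topological_space"
  assumes "complete_measure A" and f: "f \<in> borel_measurable A" and eq: "AE t in A. f t = g t"
  shows "g \<in> borel_measurable A"
proof (rule measurableI)
  fix X :: "'b set" assume "X \<in> sets borel"
  then have "f -` X \<inter> space A \<in> sets A"
    using f by (rule measurable_sets[rotated])
  moreover have "AE t in A. t \<in> f -` X \<inter> space A \<longleftrightarrow> t \<in> g -` X \<inter> space A"
    using eq by eventually_elim auto
  ultimately show "g -` X \<inter> space A \<in> sets A"
    using complete_measure.in_sets_AE[OF assms(1)] by blast
qed simp

text \<open>The norms of the simple functions have a measurable pointwise \<open>lim\<close>, but it
  equals the norm of f only almost everywhere. Completeness of the measure carries measurability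
  across the null set.\<close>

lemma strongly_measurable_norm:
  fixes f :: "'a \<Rightarrow> 'b::real_normed_vector"
  assumes A: "complete_measure A" and "strongly_measurable A f"
  shows "(\<lambda>t. norm (f t)) \<in> borel_measurable A"
proof -
  obtain s where s: "\<And>i. simple_function A (s i)" "AE t in A. (\<lambda>i. s i t) \<longlonglongrightarrow> f t"
    using assms(2) by (auto simp: strongly_measurable_def)
  have [measurable]: "(\<lambda>t. norm (s i t)) \<in> borel_measurable A" for i
    by (rule borel_measurable_simple_function) (rule simple_function_compose1[OF s(1)])
  have "(\<lambda>t. lim (\<lambda>i. norm (s i t))) \<in> borel_measurable A"
    by measurable
  moreover have "AE t in A. lim (\<lambda>i. norm (s i t)) = norm (f t)"
    using s(2) by eventually_elim (intro limI tendsto_norm)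
  ultimately show ?thesis
    by (rule borel_measurable_cong_AE[OF A])
qed

lemma strongly_measurable_diff:
  assumes "strongly_measurable A f" "strongly_measurable A g"
  shows "strongly_measurable A (\<lambda>t. f t - g t)"
proof -
  obtain s r where s: "\<And>i. simple_function A (s i)" "AE t in A. (\<lambda>i. s i t) \<longlonglongrightarrow> f t"
    and r: "\<And>i. simple_function A (r i)" "AE t in A. (\<lambda>i. r i t) \<longlonglongrightarrow> g t"
    using assms by (auto simp: strongly_measurable_def)
  have "AE t in A. (\<lambda>i. s i t - r i t) \<longlonglongrightarrow> f t - g t"
    using s(2) r(2) by eventually_elim (intro tendsto_diff)
  moreover have "simple_function A (\<lambda>t. s i t - r i t)" for i
    by (rule simple_function_compose2[OF s(1) r(1)])
  ultimately show ?thesis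
    unfolding strongly_measurable_def by (intro exI[of _ "\<lambda>i t. s i t - r i t"]) auto
qed

text \<open>For positive x and y this is convexity on the open half-line. If one of them is 0, its
  term drops out and c^p <= c for c in [0,1] is enough.\<close>

lemma convex_powr_nonneg:
  fixes x y l m p :: real
  assumes "p \<ge> 1" "x \<ge> 0" "y \<ge> 0" "l \<ge> 0" "m \<ge> 0" "l + m = 1"
  shows "(l * x + m * y) powr p \<le> l * x powr p + m * y powr p"
proof -
  have *: "(c * z) powr p \<le> c * z powr p" if "0 \<le> c" "c \<le> 1" "z \<ge> 0" for c z :: real
  proof -
    have "c powr p \<le> c powr 1"
      using that assms(1) by (intro powr_mono') auto
    then show ?thesis
      using that by (simp add: powr_mult mult_right_mono)
  qed
  show ?thesis
  proof (cases "x = 0 \<or> y = 0")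
    case True
    then show ?thesis
      using *[of l x] *[of m y] assms by auto
  next
    case False
    have "l = 1 - m" "m \<le> 1"
      using assms by auto
    then show ?thesis
      unfolding \<open>l = 1 - m\<close>
      using convex_onD[OF powr_convex[OF assms(1)], of m x y] False assms by simp
  qed
qed

text \<open>Normalisation argument: for a and b above the two norms, (|f| + |g|) / (a + b) is the
  convex combination of |f| / a and |g| / b with weights a / (a + b) and b / (a + b). Convexity of
  the power and integration bound the integral for h by (a + b)^p. Taking a and b strictly above the
  norms keeps the divisors positive when a norm is 0; at the end both are lowered to the
  norms.\<close>

lemma minkowski_powr_nn_integral:
  fixes f g h :: "'a \<Rightarrow> 'b::real_normed_vector"
  assumes p: "p \<ge> 1"
    and [measurable]: "(\<lambda>t. norm (f t)) \<in> borel_measurable A" "(\<lambda>t. norm (g t)) \<in> borel_measurable A"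
    and fin: "powr_nn_integral A p f < \<infinity>" "powr_nn_integral A p g < \<infinity>"
    and h: "\<And>t. t \<in> space A \<Longrightarrow> norm (h t) \<le> norm (f t) + norm (g t)"
  shows "powr_nn_integral A p h < \<infinity>"
    and "enn2real (powr_nn_integral A p h) powr (1 / p)
      \<le> enn2real (powr_nn_integral A p f) powr (1 / p) + enn2real (powr_nn_integral A p g) powr (1 / p)"
proof -
  define F G where "F = enn2real (powr_nn_integral A p f)" and "G = enn2real (powr_nn_integral A p g)"
  have F: "powr_nn_integral A p f = ennreal F" "F \<ge> 0" and G: "powr_nn_integral A p g = ennreal G" "G \<ge> 0"
    using fin by (auto simp: F_def G_def less_top)
  have *: "powr_nn_integral A p h \<le> ennreal ((a + b) powr p)"
    if a: "a > F powr (1 / p)" and b: "b > G powr (1 / p)" for a b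
  proof -
    have ab: "a > 0" "b > 0"
      using a b powr_ge_zero[of F "1/p"] powr_ge_zero[of G "1/p"] by linarith+
    define l m where "l = a / (a + b)" and "m = b / (a + b)"
    have lm: "l \<ge> 0" "m \<ge> 0" "l + m = 1"
      using ab by (auto simp: l_def m_def simp flip: add_divide_distrib)
    define c where "c = (a + b) powr p"
    have pt: "norm (h t) powr p \<le> c * l / a powr p * norm (f t) powr p + c * m / b powr p * norm (g t) powr p"
      if "t \<in> space A" for t
    proof -
      have eq: "norm (f t) + norm (g t) = (a + b) * (l * (norm (f t) / a) + m * (norm (g t) / b))"
        using ab lm(1) by (simp add: l_def m_def distrib_left)
      have "norm (h t) powr p \<le> (norm (f t) + norm (g t)) powr p"
        using h[OF that] p by (intro powr_mono2) auto
      also have "\<dots> = c * (l * (norm (f t) / a) + m * (norm (g t) / b)) powr p"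
        unfolding eq c_def using ab lm by (intro powr_mult)
      also have "\<dots> \<le> c * (l * (norm (f t) / a) powr p + m * (norm (g t) / b) powr p)"
        using ab lm p by (intro mult_left_mono convex_powr_nonneg) (auto simp: c_def)
      also have "\<dots> = c * l / a powr p * norm (f t) powr p + c * m / b powr p * norm (g t) powr p"
        using ab by (simp add: powr_divide algebra_simps)
      finally show ?thesis .
    qed
    have le: "F \<le> a powr p" "G \<le> b powr p"
    proof -
      have "(F powr (1 / p)) powr p \<le> a powr p" "(G powr (1 / p)) powr p \<le> b powr p"
        using a b p by (auto intro!: powr_mono2)
      then show "F \<le> a powr p" "G \<le> b powr p"
        using p F G by (simp_all add: powr_powr)
    qed
    have "powr_nn_integral A p h \<le>
        (\<integral>\<^sup>+ t. ennreal (c * l / a powr p) * ennreal (norm (f t) powr p)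
               + ennreal (c * m / b powr p) * ennreal (norm (g t) powr p) \<partial>A)"
      unfolding powr_nn_integral_def using pt lm ab
      by (intro nn_integral_mono) (simp add: c_def flip: ennreal_mult ennreal_plus)
    also have "\<dots> = ennreal (c * l / a powr p) * ennreal F + ennreal (c * m / b powr p) * ennreal G"
      by (simp add: nn_integral_add nn_integral_cmult F(1)[unfolded powr_nn_integral_def]
          G(1)[unfolded powr_nn_integral_def])
    also have "\<dots> = ennreal (c * l * (F / a powr p) + c * m * (G / b powr p))"
      using lm ab F G by (simp add: c_def flip: ennreal_mult ennreal_plus)
    also have "\<dots> \<le> ennreal (c * l * 1 + c * m * 1)"
      using le lm ab F G by (intro ennreal_leI add_mono mult_left_mono) (auto simp: c_def)
    also have "c * l * 1 + c * m * 1 = c"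
      using lm by (simp flip: distrib_left)
    finally show ?thesis by (simp add: c_def)
  qed
  show fin_h: "powr_nn_integral A p h < \<infinity>"
    using *[of "F powr (1/p) + 1" "G powr (1/p) + 1"] by (simp add: le_less_trans)
  show "enn2real (powr_nn_integral A p h) powr (1 / p) \<le> F powr (1 / p) + G powr (1 / p)"
  proof (rule field_le_epsilon)
    fix e :: real assume e: "e > 0"
    define a b where "a = F powr (1/p) + e/2" and "b = G powr (1/p) + e/2"
    have ab: "a > 0" "b > 0"
      using e powr_ge_zero[of F "1/p"] powr_ge_zero[of G "1/p"] by (auto simp: a_def b_def intro: add_nonneg_pos)
    have "powr_nn_integral A p h \<le> ennreal ((a + b) powr p)"
      using e by (intro *) (auto simp: a_def b_def)
    then have "enn2real (powr_nn_integral A p h) \<le> (a + b) powr p"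
      by (rule enn2real_leI[rotated]) simp
    then have "enn2real (powr_nn_integral A p h) powr (1/p) \<le> ((a + b) powr p) powr (1/p)"
      using p by (intro powr_mono2) auto
    also have "\<dots> = F powr (1/p) + G powr (1/p) + e"
      using ab p by (simp add: powr_powr) (simp add: a_def b_def)
    finally show "enn2real (powr_nn_integral A p h) powr (1/p) \<le> F powr (1/p) + G powr (1/p) + e" .
  qed
qed

text \<open>\<open>powr_nn_integral\<close> is the p-th power of the norm. Without the root,
  pointwise bounds integrate term by term, and convergence to 0 still passes to the norm.\<close>

lemma Lp_norm_powr_nn_integral:
  fixes f :: "real \<Rightarrow> 'b::real_normed_vector"
  assumes "p < \<infinity>"
  shows "Lp_norm p T (\<lambda>t. norm (f t)) =
    (if powr_nn_integral (lebesgue_on {0<..<T}) (enn2real p) f = \<infinity> then \<infinity>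
     else ennreal (enn2real (powr_nn_integral (lebesgue_on {0<..<T}) (enn2real p) f) powr (1 / enn2real p)))"
  using assms by (auto simp: Lp_norm_def powr_nn_integral_def Let_def)

lemma Lp_fun_iff:
  assumes "p < \<infinity>"
  shows "f \<in> Lp_fun p T \<longleftrightarrow> strongly_measurable (lebesgue_on {0<..<T}) f \<and>
    powr_nn_integral (lebesgue_on {0<..<T}) (enn2real p) f < \<infinity>"
  using assms by (auto simp: Lp_fun_def Lp_norm_powr_nn_integral less_top)

lemma enn2real_ge_1: "1 \<le> p \<Longrightarrow> p < \<infinity> \<Longrightarrow> 1 \<le> enn2real p" for p :: ennreal
  using enn2real_mono[of 1 p] by (simp add: less_top)

lemma norm_Lp_fun_measurable:
  fixes f :: "real \<Rightarrow> 'b::real_normed_vector"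
  assumes "strongly_measurable (lebesgue_on {0<..<T}) f"
  shows "(\<lambda>t. norm (f t)) \<in> borel_measurable (lebesgue_on {0<..<T})"
  by (rule strongly_measurable_norm[OF complete_measure_lebesgue_on assms]) simp

lemma powr_nn_integral_eq_0_iff:
  assumes "(\<lambda>t. norm (f t)) \<in> borel_measurable A"
  shows "powr_nn_integral A p f = 0 \<longleftrightarrow> (AE t in A. f t = 0)"
proof -
  have "powr_nn_integral A p f = 0 \<longleftrightarrow> (AE t in A. ennreal (norm (f t) powr p) = 0)"
    unfolding powr_nn_integral_def using assms by (subst nn_integral_0_iff_AE) auto
  then show ?thesis
    by (simp add: ennreal_eq_0_iff)
qed

lemma powr_nn_integral_cong_AE:
  assumes "AE t in A. f t = g t"
  shows "powr_nn_integral A p f = powr_nn_integral A p g"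
  unfolding powr_nn_integral_def using assms by (intro nn_integral_cong_AE) auto

section \<open>The metric on classes, convergence and relative compactness\<close>

context
  fixes p :: ennreal and T :: real
  assumes p: "1 \<le> p" "p < \<infinity>"
begin

private abbreviation (input) "A \<equiv> lebesgue_on {0<..<T}"
private abbreviation (input) "P \<equiv> enn2real p"

lemma Lp_fun_diff:
  assumes "f \<in> Lp_fun p T" "g \<in> Lp_fun p T"
  shows "(\<lambda>t. f t - g t) \<in> Lp_fun p T"
  using assms minkowski_powr_nn_integral(1)[OF enn2real_ge_1[OF p], of f A g "\<lambda>t. f t - g t"]
  unfolding Lp_fun_iff[OF p(2)]
  by (simp add: strongly_measurable_diff norm_Lp_fun_measurable norm_triangle_ineq4)

lemma Lp_class_self: "f \<in> Lp_fun p T \<Longrightarrow> f \<in> Lp_class p T f"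
  by (simp add: Lp_class_def)

text \<open>\<open>Lp_dist\<close> evaluates representatives picked by \<open>SOME\<close>. These
  agree almost everywhere with f and g, and the integral does not see the difference.\<close>

lemma Lp_dist_class:
  fixes f g :: "real \<Rightarrow> 'b::real_normed_vector"
  assumes f: "f \<in> Lp_fun p T" and g: "g \<in> Lp_fun p T"
  shows "Lp_dist p T (Lp_class p T f) (Lp_class p T g) =
    enn2real (powr_nn_integral A P (\<lambda>t. f t - g t)) powr (1 / P)"
proof -
  define f' g' where "f' = (SOME u. u \<in> Lp_class p T f)" and "g' = (SOME u. u \<in> Lp_class p T g)"
  have "f' \<in> Lp_class p T f" "g' \<in> Lp_class p T g"
    unfolding f'_def g'_def using Lp_class_self[OF f] Lp_class_self[OF g] by (metis someI_ex)+
  then have AE: "AE t in A. f' t = f t" "AE t in A. g' t = g t"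
    and f'g': "f' \<in> Lp_fun p T" "g' \<in> Lp_fun p T"
    by (auto simp: Lp_class_def)
  have eq: "powr_nn_integral A P (\<lambda>t. f' t - g' t) = powr_nn_integral A P (\<lambda>t. f t - g t)"
    using AE by (intro powr_nn_integral_cong_AE) auto
  have "powr_nn_integral A P (\<lambda>t. f t - g t) < \<infinity>"
    using Lp_fun_diff[OF f g] Lp_fun_iff[OF p(2)] by blast
  then show ?thesis
    unfolding Lp_dist_def f'_def[symmetric] g'_def[symmetric] Lp_norm_powr_nn_integral[OF p(2)] eq
    by simp
qed

lemma Lp_class_eq_iff:
  assumes f: "f \<in> Lp_fun p T" and g: "g \<in> Lp_fun p T"
  shows "Lp_class p T f = Lp_class p T g \<longleftrightarrow> (AE t in A. f t = g t)"
proof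
  assume "Lp_class p T f = Lp_class p T g"
  then have "f \<in> Lp_class p T g"
    using Lp_class_self[OF f] by simp
  then show "AE t in A. f t = g t"
    by (simp add: Lp_class_def)
next
  assume "AE t in A. f t = g t"
  then have "(AE t in A. v t = f t) \<longleftrightarrow> (AE t in A. v t = g t)" for v
    by (intro iffI; auto elim!: eventually_elim2)
  then show "Lp_class p T f = Lp_class p T g"
    by (simp add: Lp_class_def)
qed

lemma Metric_space_Lp:
  "Metric_space (Lp_space p T :: (real \<Rightarrow> 'b::real_normed_vector) set set) (Lp_dist p T)"
proof
  fix X Y Z :: "(real \<Rightarrow> 'b) set"
  show "0 \<le> Lp_dist p T X Y"
    by (simp add: Lp_dist_def)
  show "Lp_dist p T X Y = Lp_dist p T Y X"
    by (simp add: Lp_dist_def norm_minus_commute)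
  assume "X \<in> Lp_space p T" "Y \<in> Lp_space p T"
  then obtain f g where f: "f \<in> Lp_fun p T" "X = Lp_class p T f" and g: "g \<in> Lp_fun p T" "Y = Lp_class p T g"
    by (auto simp: Lp_space_def)
  have fg: "(\<lambda>t. f t - g t) \<in> Lp_fun p T"
    by (rule Lp_fun_diff[OF f(1) g(1)])
  then have "powr_nn_integral A P (\<lambda>t. f t - g t) < \<infinity>"
    using Lp_fun_iff[OF p(2)] by blast
  then have "Lp_dist p T X Y = 0 \<longleftrightarrow> powr_nn_integral A P (\<lambda>t. f t - g t) = 0"
    using Lp_dist_class[OF f(1) g(1)] f(2) g(2) by (auto simp: enn2real_eq_0_iff)
  also have "\<dots> \<longleftrightarrow> (AE t in A. f t = g t)"
    using fg Lp_fun_iff[OF p(2)] norm_Lp_fun_measurable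
    by (subst powr_nn_integral_eq_0_iff) fastforce+
  finally show "Lp_dist p T X Y = 0 \<longleftrightarrow> X = Y"
    using Lp_class_eq_iff[OF f(1) g(1)] f(2) g(2) by simp
  assume "Z \<in> Lp_space p T"
  then obtain h where h: "h \<in> Lp_fun p T" "Z = Lp_class p T h"
    by (auto simp: Lp_space_def)
  have gh: "(\<lambda>t. g t - h t) \<in> Lp_fun p T"
    by (rule Lp_fun_diff[OF g(1) h(1)])
  have tri: "norm (f t - h t) \<le> norm (f t - g t) + norm (g t - h t)" for t
    using norm_triangle_ineq[of "f t - g t" "g t - h t"] by simp
  show "Lp_dist p T X Z \<le> Lp_dist p T X Y + Lp_dist p T Y Z"
    using fg gh unfolding f(2) g(2) h(2) Lp_dist_class[OF f(1) g(1)] Lp_dist_class[OF g(1) h(1)]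
      Lp_dist_class[OF f(1) h(1)] Lp_fun_iff[OF p(2)]
    by (intro minkowski_powr_nn_integral(2)[OF enn2real_ge_1[OF p]] norm_Lp_fun_measurable tri) auto
qed

lemma limitin_LpI:
  fixes f :: "nat \<Rightarrow> real \<Rightarrow> 'b::real_normed_vector"
  assumes f: "\<And>n. f n \<in> Lp_fun p T" and g: "g \<in> Lp_fun p T"
    and lim: "(\<lambda>n. powr_nn_integral A P (\<lambda>t. f n t - g t)) \<longlonglongrightarrow> 0"
  shows "limitin (Lp_topology p T) (\<lambda>n. Lp_class p T (f n)) (Lp_class p T g) sequentially"
proof -
  interpret L: Metric_space "Lp_space p T :: (real \<Rightarrow> 'b) set set" "Lp_dist p T"
    by (rule Metric_space_Lp)
  have "(\<lambda>n. enn2real (powr_nn_integral A P (\<lambda>t. f n t - g t))) \<longlonglongrightarrow> enn2real 0"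
    using lim by (intro tendsto_enn2real) auto
  then have "(\<lambda>n. enn2real (powr_nn_integral A P (\<lambda>t. f n t - g t)) powr (1 / P)) \<longlonglongrightarrow> 0"
    using enn2real_ge_1[OF p] by (intro tendsto_zero_powrI[OF _ tendsto_const]) auto
  then show ?thesis
    unfolding Lp_topology_def L.limitin_metric_dist_null
    using f g by (auto simp: Lp_space_def Lp_dist_class)
qed

lemma Lp_convergesI:
  assumes "\<And>n. f n \<in> Lp_fun p T" "g \<in> Lp_fun p T"
    and "(\<lambda>n. powr_nn_integral A P (\<lambda>t. f n t - g t)) \<longlonglongrightarrow> 0"
  shows "Lp_converges p T f g"
  using assms limitin_LpI[OF assms] by (simp add: Lp_converges_def)

text \<open>By Bolzano-Weierstrass it suffices to extract convergent subsequences from sequences of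
  classes of members of the range. Such a sequence lifts to indices \<open>\<sigma>\<close> that may
  repeat or go backwards, which is why \<open>sub\<close> speaks of arbitrary
  \<open>\<sigma>\<close> and not only of subsequences.\<close>

lemma Lp_relatively_compactI:
  fixes u :: "nat \<Rightarrow> real \<Rightarrow> 'b::real_normed_vector"
  assumes u: "\<And>n. u n \<in> Lp_fun p T"
    and sub: "\<And>\<sigma> :: nat \<Rightarrow> nat. \<exists>s g. strict_mono s \<and> g \<in> Lp_fun p T \<and>
      (\<lambda>n. powr_nn_integral A P (\<lambda>t. u (\<sigma> (s n)) t - g t)) \<longlonglongrightarrow> 0"
  shows "Lp_relatively_compact p T (range u)"
proof -
  interpret L: Metric_space "Lp_space p T :: (real \<Rightarrow> 'b) set set" "Lp_dist p T"
    by (rule Metric_space_Lp)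
  have "L.mtopology derived_set_of X \<noteq> {}" if "infinite X" and X: "X \<subseteq> Lp_class p T ` range u" for X
  proof -
    have X': "X \<subseteq> Lp_space p T"
      using X u by (auto simp: Lp_space_def)
    have "\<forall>x :: nat \<Rightarrow> (real \<Rightarrow> 'b) set. range x \<subseteq> X \<longrightarrow>
        (\<exists>l r. l \<in> Lp_space p T \<and> strict_mono r \<and> limitin L.mtopology (x \<circ> r) l sequentially)"
    proof (intro allI impI)
      fix x :: "nat \<Rightarrow> (real \<Rightarrow> 'b) set" assume "range x \<subseteq> X"
      then have "\<forall>n. \<exists>k. x n = Lp_class p T (u k)"
        using X by blast
      then obtain \<sigma> where \<sigma>: "\<And>n. x n = Lp_class p T (u (\<sigma> n))"
        by metis
      obtain s g where s: "strict_mono s" "g \<in> Lp_fun p T"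
        "(\<lambda>n. powr_nn_integral A P (\<lambda>t. u (\<sigma> (s n)) t - g t)) \<longlonglongrightarrow> 0"
        using sub by blast
      have "limitin L.mtopology (x \<circ> s) (Lp_class p T g) sequentially"
        using limitin_LpI[of "\<lambda>n. u (\<sigma> (s n))", OF u s(2,3)] by (simp add: \<sigma> Lp_topology_def o_def)
      then show "\<exists>l r. l \<in> Lp_space p T \<and> strict_mono r \<and> limitin L.mtopology (x \<circ> r) l sequentially"
        using s by (auto simp: Lp_space_def)
    qed
    then have "Lp_space p T \<inter> L.mtopology derived_set_of X \<noteq> {}"
      using L.Bolzano_Weierstrass_property[OF X' X'] \<open>infinite X\<close> by blast
    then show ?thesis by blast
  qed
  then have "compactin L.mtopology (L.mtopology closure_of (Lp_class p T ` range u))"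
    unfolding L.compact_closure_of_eq_Bolzano_Weierstrass by blast
  then show ?thesis
    using u by (auto simp: Lp_relatively_compact_def Lp_topology_def)
qed

end

section \<open>Completeness and compactness\<close>

lemma diagonal_convergent_subseq:
  fixes a :: "nat \<Rightarrow> nat \<Rightarrow> 'b::topological_space"
  assumes "\<And>i s. strict_mono (s :: nat \<Rightarrow> nat) \<Longrightarrow>
    \<exists>r. strict_mono (r :: nat \<Rightarrow> nat) \<and> convergent (\<lambda>n. a (s (r n)) i)"
  shows "\<exists>s. strict_mono (s :: nat \<Rightarrow> nat) \<and> (\<forall>i. convergent (\<lambda>n. a (s n) i))"
proof -
  interpret S: subseqs "\<lambda>i s. convergent (\<lambda>n. a (s n) i)"
    by standard (use assms in \<open>simp add: o_def\<close>)
  have "convergent (\<lambda>n. a (S.diagseq n) i)" for i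
  proof -
    \<comment> \<open>The diagonal sequence is a subsequence of the one chosen at stage i only after
      its first terms, hence the shift by \<open>Suc i\<close>.\<close>
    have "convergent (\<lambda>n. a ((S.diagseq \<circ> (+) (Suc i)) n) i)"
    proof (rule S.diagseq_holds)
      fix r s :: "nat \<Rightarrow> nat" and k
      assume "strict_mono r" "convergent (\<lambda>n. a (s n) k)"
      then show "convergent (\<lambda>n. a ((s \<circ> r) n) k)"
        using convergent_subseq_convergent[of "\<lambda>n. a (s n) k" r] by (simp add: o_def)
    qed
    then have "convergent (\<lambda>n. a (S.diagseq (n + Suc i)) i)"
      by (simp add: o_def add.commute)
    then show ?thesis
      using convergent_ignore_initial_segment[of "\<lambda>n. a (S.diagseq n) i" "Suc i"] by blast
  qed
  then show ?thesis
    using S.subseq_diagseq by blast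
qed

lemma strongly_measurable_LIMSEQ_simple:
  assumes "\<And>n. simple_function A (f n)" "AE t in A. (\<lambda>n. f n t) \<longlonglongrightarrow> g t"
  shows "strongly_measurable A g"
  using assms unfolding strongly_measurable_def by blast

text \<open>The Riesz-Fischer argument. Along a fast subsequence the p-th powers of the increments,
  weighted by 2^(kp), have an integrable sum. Where that sum is finite, the k-th increment is at
  most a constant times 2^(-k), so the values converge in the Banach space. Fatou's lemma turns the
  Cauchy bounds into convergence to the limit.\<close>

lemma powr_nn_integral_Cauchy_subseq:
  fixes f :: "nat \<Rightarrow> 'a \<Rightarrow> 'b::banach"
  assumes p: "p > 0" and f: "\<And>n. simple_function A (f n)"
    and Cauchy: "\<And>e. e > 0 \<Longrightarrow> \<exists>N. \<forall>m\<ge>N. \<forall>n\<ge>N. powr_nn_integral A p (\<lambda>t. f m t - f n t) \<le> ennreal e"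
  shows "\<exists>s g. strict_mono (s :: nat \<Rightarrow> nat) \<and> strongly_measurable A g \<and>
    (\<lambda>n. powr_nn_integral A p (\<lambda>t. f (s n) t - g t)) \<longlonglongrightarrow> 0"
proof -
  \<comment> \<open>The denominator cancels the weight (2^k)^p of \<open>D k\<close> below and
    leaves the summable bound (1/2)^k.\<close>
  define e where "e k = (1/2)^k / (2^k) powr p" for k :: nat
  have "\<exists>N. \<forall>k. \<forall>m\<ge>N k. \<forall>n\<ge>N k. powr_nn_integral A p (\<lambda>t. f m t - f n t) \<le> ennreal (e k)"
    using Cauchy[of "e k" for k] by (intro choice) (auto simp: e_def)
  then obtain N where N: "\<And>k m n. m \<ge> N k \<Longrightarrow> n \<ge> N k \<Longrightarrow>
      powr_nn_integral A p (\<lambda>t. f m t - f n t) \<le> ennreal (e k)"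
    by blast
  have "\<exists>s. \<forall>k. N k \<le> s k \<and> s k < s (Suc k)"
  proof (rule dependent_nat_choice)
    show "\<exists>y. N (Suc k) \<le> y \<and> x < y" for x k
      by (rule exI[of _ "max (N (Suc k)) (Suc x)"]) auto
  qed auto
  then obtain s where s: "\<And>k. N k \<le> s k" "strict_mono s"
    by (auto simp: strict_mono_Suc_iff)
  have [measurable]: "(\<lambda>t. norm (f m t - f n t)) \<in> borel_measurable A" for m n
    by (intro borel_measurable_simple_function simple_function_compose2[OF f f])
  define D where "D k t = 2^k * norm (f (s (Suc k)) t - f (s k) t)" for k t
  have [measurable]: "D k \<in> borel_measurable A" for k
    unfolding D_def by measurable
  have "(\<integral>\<^sup>+ t. ennreal (D k t powr p) \<partial>A) \<le> ennreal ((1/2)^k)" for k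
  proof -
    have "(\<integral>\<^sup>+ t. ennreal (D k t powr p) \<partial>A)
        = (\<integral>\<^sup>+ t. ennreal ((2^k) powr p) * ennreal (norm (f (s (Suc k)) t - f (s k) t) powr p) \<partial>A)"
      by (simp add: D_def powr_mult ennreal_mult)
    also have "\<dots> = ennreal ((2^k) powr p) * powr_nn_integral A p (\<lambda>t. f (s (Suc k)) t - f (s k) t)"
      unfolding powr_nn_integral_def by (rule nn_integral_cmult) measurable
    also have "\<dots> \<le> ennreal ((2^k) powr p) * ennreal (e k)"
      using s(1)[of k] strict_monoD[OF s(2), of k "Suc k"]
      by (intro mult_left_mono N) auto
    also have "\<dots> = ennreal ((1/2)^k)"
      by (simp add: e_def flip: ennreal_mult)
    finally show ?thesis .
  qed
  then have "(\<integral>\<^sup>+ t. (\<Sum>k. ennreal (D k t powr p)) \<partial>A) \<le> (\<Sum>k. ennreal ((1/2)^k))"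
    by (subst nn_integral_suminf) (auto intro!: suminf_le)
  also have "\<dots> = ennreal (\<Sum>k. (1/2)^k)"
    by (rule suminf_ennreal2) (auto simp: summable_geometric)
  also have "\<dots> < \<infinity>"
    by simp
  finally have "AE t in A. (\<Sum>k. ennreal (D k t powr p)) \<noteq> \<infinity>"
    by (intro nn_integral_PInf_AE) auto
  then have AE_lim: "AE t in A. (\<lambda>k. f (s k) t) \<longlonglongrightarrow> lim (\<lambda>k. f (s k) t)"
  proof eventually_elim
    case (elim t)
    then obtain B where B: "(\<Sum>k. ennreal (D k t powr p)) = ennreal B" "B \<ge> 0"
      by (metis ennreal_cases infinity_ennreal_def)
    have bound: "norm (f (s (Suc k)) t - f (s k) t) \<le> B powr (1/p) * (1/2)^k" for k
    proof -
      have term_le: "h k \<le> suminf h" for h :: "nat \<Rightarrow> ennreal"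
        using sum_le_suminf[OF summableI, of "{k}" h] by simp
      have "ennreal (D k t powr p) \<le> ennreal B"
        using term_le[of "\<lambda>k. ennreal (D k t powr p)"] by (simp only: B)
      then have "D k t powr p \<le> B"
        using B(2) by (simp only: ennreal_le_iff)
      then have "(D k t powr p) powr (1/p) \<le> B powr (1/p)"
        using p by (intro powr_mono2) auto
      then have "D k t \<le> B powr (1/p)"
        using p by (simp add: powr_powr D_def)
      then show ?thesis
        by (simp add: D_def field_simps)
    qed
    have "summable (\<lambda>k. B powr (1/p) * (1/2)^k)"
      by (intro summable_mult summable_geometric) auto
    then have "summable (\<lambda>k. f (s (Suc k)) t - f (s k) t)"
      by (rule summable_comparison_test'[where N=0]) (rule bound)
    then have "convergent (\<lambda>n. f (s n) t - f (s 0) t)"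
      unfolding summable_iff_convergent by (simp add: sum_lessThan_telescope[of "\<lambda>k. f (s k) t"])
    then have "convergent (\<lambda>n. f (s n) t)"
      using convergent_add[OF _ convergent_const[of "f (s 0) t"]] by fastforce
    then show ?case
      by (simp add: convergent_LIMSEQ_iff)
  qed
  define g where "g t = lim (\<lambda>k. f (s k) t)" for t
  have AE_g: "AE t in A. (\<lambda>k. f (s k) t) \<longlonglongrightarrow> g t"
    using AE_lim by (simp add: g_def)
  \<comment> \<open>Here n stays fixed and j tends to infinity, so a bound on the distance between
    members n and j becomes one on the distance to g.\<close>
  have Fatou: "powr_nn_integral A p (\<lambda>t. f (s n) t - g t) \<le> ennreal e"
    if ev: "\<And>j. j \<ge> K \<Longrightarrow> powr_nn_integral A p (\<lambda>t. f (s n) t - f (s j) t) \<le> ennreal e" for n e K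
  proof -
    have "powr_nn_integral A p (\<lambda>t. f (s n) t - g t)
        = (\<integral>\<^sup>+ t. liminf (\<lambda>j. ennreal (norm (f (s n) t - f (s j) t) powr p)) \<partial>A)"
      unfolding powr_nn_integral_def
    proof (rule nn_integral_cong_AE)
      show "AE t in A. ennreal (norm (f (s n) t - g t) powr p) =
          liminf (\<lambda>j. ennreal (norm (f (s n) t - f (s j) t) powr p))"
        using AE_g
      proof eventually_elim
        case (elim t)
        have "(\<lambda>j. ennreal (norm (f (s n) t - f (s j) t) powr p)) \<longlonglongrightarrow>
            ennreal (norm (f (s n) t - g t) powr p)"
          using p by (intro tendsto_ennrealI tendsto_powr2 tendsto_norm tendsto_diff elim tendsto_const) auto
        then show ?case
          by (intro lim_imp_Liminf[symmetric]) auto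
      qed
    qed
    also have "\<dots> \<le> liminf (\<lambda>j. powr_nn_integral A p (\<lambda>t. f (s n) t - f (s j) t))"
      unfolding powr_nn_integral_def by (intro nn_integral_liminf) measurable
    also have "\<dots> \<le> liminf (\<lambda>j. ennreal e)"
      using ev by (intro Liminf_mono) (auto simp: eventually_sequentially)
    finally show ?thesis
      by (simp add: Liminf_const)
  qed
  have "(\<lambda>n. powr_nn_integral A p (\<lambda>t. f (s n) t - g t)) \<longlonglongrightarrow> 0"
  proof (rule order_tendstoI)
    fix a :: ennreal assume "a > 0"
    then obtain e where e: "e > 0" "ennreal e < a"
    proof (cases a)
      case (real r)
      then show ?thesis
        using that[of "r / 2"] \<open>a > 0\<close> by (simp add: ennreal_less_iff)
    next
      case top
      then show ?thesis
        using that[of 1] by simp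
    qed
    obtain K where K: "\<And>m n. m \<ge> K \<Longrightarrow> n \<ge> K \<Longrightarrow> powr_nn_integral A p (\<lambda>t. f m t - f n t) \<le> ennreal e"
      using Cauchy[OF e(1)] by blast
    have "powr_nn_integral A p (\<lambda>t. f (s n) t - g t) \<le> ennreal e" if "n \<ge> K" for n
      using that seq_suble[OF s(2)] by (intro Fatou[of K] K) (meson order_trans)+
    then show "\<forall>\<^sub>F n in sequentially. powr_nn_integral A p (\<lambda>t. f (s n) t - g t) < a"
      using e(2) unfolding eventually_sequentially by (meson le_less_trans)
  qed simp
  moreover have "strongly_measurable A g"
    by (rule strongly_measurable_LIMSEQ_simple[OF f AE_g])
  ultimately show ?thesis
    using s(2) by blast
qed

section \<open>Vectors common to both spaces and the Ehrling inequality on the cone\<close>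

lemma in_both_diff:
  assumes "linear \<iota>" "linear \<kappa>" "inj \<kappa>" "in_both \<iota> \<kappa> x" "in_both \<iota> \<kappa> y"
  shows "in_both \<iota> \<kappa> (x - y)"
    and "as_other \<iota> \<kappa> (x - y) = as_other \<iota> \<kappa> x - as_other \<iota> \<kappa> y"
proof -
  obtain x' y' where eq: "\<iota> x = \<kappa> x'" "\<iota> y = \<kappa> y'"
    using assms(4,5) by (auto simp: in_both_def)
  then have "\<iota> (x - y) = \<kappa> (x' - y')"
    using assms(1,2) by (simp add: linear_diff)
  then show "in_both \<iota> \<kappa> (x - y)"
    "as_other \<iota> \<kappa> (x - y) = as_other \<iota> \<kappa> x - as_other \<iota> \<kappa> y"
    using eq assms(3) by (auto simp: in_both_def as_other_def)
qed

lemma in_both_scaleR: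
  assumes "linear \<iota>" "linear \<kappa>" "inj \<kappa>" "in_both \<iota> \<kappa> x"
  shows "in_both \<iota> \<kappa> (c *\<^sub>R x)"
    and "as_other \<iota> \<kappa> (c *\<^sub>R x) = c *\<^sub>R as_other \<iota> \<kappa> x"
proof -
  obtain x' where eq: "\<iota> x = \<kappa> x'"
    using assms(4) by (auto simp: in_both_def)
  then have "\<iota> (c *\<^sub>R x) = \<kappa> (c *\<^sub>R x')"
    using assms(1,2) by (simp add: linear_scale)
  then show "in_both \<iota> \<kappa> (c *\<^sub>R x)"
    "as_other \<iota> \<kappa> (c *\<^sub>R x) = c *\<^sub>R as_other \<iota> \<kappa> x"
    using eq assms(3) by (auto simp: in_both_def as_other_def)
qed

lemma compactly_embeddedD:
  assumes "compactly_embedded M sn" "\<And>n. u n \<in> M" "\<And>n. sn (u n) \<le> R"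
  obtains s where "strict_mono (s :: nat \<Rightarrow> nat)" "convergent (\<lambda>n. u (s n))"
proof -
  have "bdd_above (range (\<lambda>n. sn (u n)))"
    using assms(3) by (auto simp: bdd_above_def)
  then show ?thesis
    using assms(1,2) that unfolding compactly_embedded_def convergent_def by metis
qed

text \<open>An unbounded sequence with bounded \<open>sn\<close> would have a convergent, hence
  bounded, subsequence. The bound later supplies the dominating constant for p infinite.\<close>

lemma compactly_embedded_bounded:
  fixes M :: "'b::real_normed_vector set"
  assumes "compactly_embedded M sn"
  shows "\<exists>B. \<forall>x\<in>M. sn x \<le> R \<longrightarrow> norm x \<le> B"
proof (rule ccontr)
  assume "\<not> ?thesis"
  then have "\<exists>x. x \<in> M \<and> sn x \<le> R \<and> norm x > real n" for n
    by (metis not_le)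
  then obtain x where x: "\<And>n. x n \<in> M" "\<And>n. sn (x n) \<le> R" "\<And>n. norm (x n) > real n"
    by metis
  obtain s where s: "strict_mono s" "convergent (\<lambda>n. x (s n))"
    by (rule compactly_embeddedD[OF assms x(1,2)])
  obtain B where "\<And>n. norm (x (s n)) \<le> B"
    using convergent_imp_Bseq[OF s(2)] by (auto simp: Bseq_def)
  moreover obtain n where "B < real n"
    using reals_Archimedean2 by blast
  moreover have "real n \<le> real (s n)"
    using seq_suble[OF s(1)] by simp
  ultimately show False
    using x(3)[of "s n"] by (smt (verit))
qed

text \<open>If the inequality fails for every c = n, both sides being positively homogeneous allows
  scaling the counterexamples to \<open>sn x + sn y = 1\<close>. Compactness is applied to x and y
  separately, as x - y may lie outside \<open>M\<close>. The differences then converge in B and stay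
  bounded there, so their Y-norms are at most B / n. By \<open>closed\<close> the limit is 0,
  although all the differences have norm at least \<open>\<epsilon>\<close>.\<close>

lemma ehrling_cone:
  fixes \<iota> :: "'b::real_normed_vector \<Rightarrow> 'v::real_vector" and \<kappa> :: "'y::real_normed_vector \<Rightarrow> 'v"
  assumes emb: "linear \<iota>" "linear \<kappa>" "inj \<kappa>"
    and cone: "seminormed_cone M sn" and cpt: "compactly_embedded M sn"
    and closed: "\<And>(w :: nat \<Rightarrow> 'b) w0. w \<longlonglongrightarrow> w0 \<Longrightarrow> (\<And>n. in_both \<iota> \<kappa> (w n)) \<Longrightarrow>
         (\<lambda>n. as_other \<iota> \<kappa> (w n)) \<longlonglongrightarrow> 0 \<Longrightarrow> w0 = 0"
    and e: "\<epsilon> > 0"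
  shows "\<exists>c\<ge>0. \<forall>x\<in>M. \<forall>y\<in>M. in_both \<iota> \<kappa> x \<longrightarrow> in_both \<iota> \<kappa> y \<longrightarrow>
    norm (x - y) \<le> \<epsilon> * (sn x + sn y) + c * norm (as_other \<iota> \<kappa> x - as_other \<iota> \<kappa> y)"
proof (rule ccontr)
  assume neg: "\<not> ?thesis"
  have "\<exists>x y. x \<in> M \<and> y \<in> M \<and> in_both \<iota> \<kappa> x \<and> in_both \<iota> \<kappa> y \<and> sn x \<le> 1 \<and> sn y \<le> 1 \<and>
      norm (x - y) > \<epsilon> + real n * norm (as_other \<iota> \<kappa> (x - y))" for n
  proof -
    obtain x y where xy: "x \<in> M" "y \<in> M" "in_both \<iota> \<kappa> x" "in_both \<iota> \<kappa> y"
      and gt: "norm (x - y) > \<epsilon> * (sn x + sn y) + real n * norm (as_other \<iota> \<kappa> x - as_other \<iota> \<kappa> y)"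
      using neg by (metis not_le of_nat_0_le_iff)
    have sn: "sn x \<ge> 0" "sn y \<ge> 0" "sn x = 0 \<longleftrightarrow> x = 0" "sn y = 0 \<longleftrightarrow> y = 0"
      using cone xy by (auto simp: seminormed_cone_def)
    define c where "c = 1 / (sn x + sn y)"
    \<comment> \<open>Definiteness is what permits the scaling: if both values were 0, then x = y =
      0 and the strict inequality \<open>gt\<close> would read 0 > 0.\<close>
    have pos: "sn x + sn y > 0"
    proof (rule ccontr)
      assume "\<not> sn x + sn y > 0"
      then have "x = 0" "y = 0"
        using sn by auto
      then show False
        using gt sn by simp
    qed
    then have c: "c > 0" "c * (sn x + sn y) = 1"
      by (auto simp: c_def)
    have "c * norm (x - y) > c * (\<epsilon> * (sn x + sn y) + real n * norm (as_other \<iota> \<kappa> (x - y)))"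
      using gt c in_both_diff(2)[OF emb xy(3,4)] by simp
    also have "c * (\<epsilon> * (sn x + sn y) + real n * norm (as_other \<iota> \<kappa> (x - y)))
        = \<epsilon> * (c * (sn x + sn y)) + real n * (c * norm (as_other \<iota> \<kappa> (x - y)))"
      by (simp add: algebra_simps)
    finally have "norm (c *\<^sub>R x - c *\<^sub>R y) >
        \<epsilon> + real n * norm (as_other \<iota> \<kappa> (c *\<^sub>R x - c *\<^sub>R y))"
      using c in_both_scaleR[OF emb in_both_diff(1)[OF emb xy(3,4)], of c]
      by (simp flip: scaleR_diff_right)
    moreover have "c *\<^sub>R x \<in> M" "c *\<^sub>R y \<in> M" "sn (c *\<^sub>R x) = c * sn x" "sn (c *\<^sub>R y) = c * sn y"
      using cone xy c by (auto simp: seminormed_cone_def)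
    moreover have "c * sn x \<le> 1" "c * sn y \<le> 1"
      using c sn pos by (auto simp: c_def)
    ultimately show ?thesis
      using in_both_scaleR(1)[OF emb xy(3), of c] in_both_scaleR(1)[OF emb xy(4), of c]
      by (intro exI[of _ "c *\<^sub>R x"] exI[of _ "c *\<^sub>R y"]) simp
  qed
  then obtain x y where xy: "\<And>n. x n \<in> M" "\<And>n. y n \<in> M" "\<And>n. in_both \<iota> \<kappa> (x n)"
      "\<And>n. in_both \<iota> \<kappa> (y n)" "\<And>n. sn (x n) \<le> 1" "\<And>n. sn (y n) \<le> 1"
    and gt: "\<And>n. norm (x n - y n) > \<epsilon> + real n * norm (as_other \<iota> \<kappa> (x n - y n))"
    by metis
  obtain s where s: "strict_mono s" "convergent (\<lambda>n. x (s n))"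
    by (rule compactly_embeddedD[OF cpt xy(1,5)])
  obtain r where r: "strict_mono r" "convergent (\<lambda>n. y (s (r n)))"
    by (rule compactly_embeddedD[OF cpt xy(2,6)])
  define q where "q n = s (r n)" for n
  have "convergent (\<lambda>n. x (q n))"
    using convergent_subseq_convergent[OF s(2) r(1)] by (simp add: q_def o_def)
  then have "convergent (\<lambda>n. x (q n) - y (q n))"
    using r(2) by (auto simp: q_def intro: convergent_diff)
  then obtain l where l: "(\<lambda>n. x (q n) - y (q n)) \<longlonglongrightarrow> l"
    by (auto simp: convergent_def)
  obtain B where B: "\<And>n. norm (x (q n) - y (q n)) \<le> B"
    using convergent_imp_Bseq[of "\<lambda>n. x (q n) - y (q n)"] l by (auto simp: Bseq_def convergent_def)
  have q: "n \<le> q n" for n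
    using seq_suble[OF strict_mono_o[OF s(1) r(1)], of n] by (simp add: q_def)
  have bound: "norm (as_other \<iota> \<kappa> (x (q n) - y (q n))) \<le> B * inverse (real n)" if "n \<ge> 1" for n
  proof -
    have "real n * norm (as_other \<iota> \<kappa> (x (q n) - y (q n)))
        \<le> real (q n) * norm (as_other \<iota> \<kappa> (x (q n) - y (q n)))"
      using q[of n] by (intro mult_right_mono) auto
    also have "\<dots> \<le> B"
      using gt[of "q n"] B[of n] e by linarith
    finally show ?thesis
      using that by (simp add: field_simps)
  qed
  have "\<forall>\<^sub>F n in sequentially. norm (as_other \<iota> \<kappa> (x (q n) - y (q n))) \<le> B * inverse (real n)"
    using eventually_ge_at_top[of 1] by eventually_elim (rule bound)
  moreover have "(\<lambda>n. B * inverse (real n)) \<longlonglongrightarrow> 0"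
    using tendsto_mult[OF tendsto_const lim_inverse_n, of B] by simp
  ultimately have "(\<lambda>n. as_other \<iota> \<kappa> (x (q n) - y (q n))) \<longlonglongrightarrow> 0"
    by (rule Lim_null_comparison)
  then have "l = 0"
    using closed[OF l] in_both_diff(1)[OF emb xy(3,4)] by simp
  moreover have "norm l \<ge> \<epsilon>"
  proof (rule LIMSEQ_le_const[OF tendsto_norm[OF l]])
    have "\<epsilon> \<le> norm (x (q n) - y (q n))" for n
    proof -
      have "0 \<le> real (q n) * norm (as_other \<iota> \<kappa> (x (q n) - y (q n)))"
        by simp
      then show ?thesis
        using gt[of "q n"] by linarith
    qed
    then show "\<exists>N. \<forall>n\<ge>N. \<epsilon> \<le> norm (x (q n) - y (q n))" by blast
  qed
  ultimately show False
    using e by simp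
qed

section \<open>Step functions\<close>

lemma emeasure_lebesgue_on_Ioo:
  fixes a b T :: real
  assumes "0 \<le> a" "a \<le> b" "b \<le> T"
  shows "emeasure (lebesgue_on {0<..<T}) {a<..<b} = ennreal (b - a)"
  using assms by (subst emeasure_restrict_space) (auto simp: emeasure_completion)

text \<open>A nondegenerate interval has positive measure and so cannot lie in the exceptional null
  set.\<close>

lemma AE_lebesgue_on_ex:
  fixes a b T :: real
  assumes AE: "AE t in lebesgue_on {0<..<T}. P t" and ab: "0 \<le> a" "a < b" "b \<le> T"
  shows "\<exists>t\<in>{a<..<b}. P t"
proof (rule ccontr)
  assume neg: "\<not> ?thesis"
  obtain X where X: "{t \<in> space (lebesgue_on {0<..<T}). \<not> P t} \<subseteq> X"
    "emeasure (lebesgue_on {0<..<T}) X = 0" "X \<in> sets (lebesgue_on {0<..<T})"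
    using AE by (rule AE_E)
  have "{a<..<b} \<subseteq> X"
    using neg X(1) ab by force
  then have "emeasure (lebesgue_on {0<..<T}) {a<..<b} \<le> 0"
    using emeasure_mono[of "{a<..<b}" X "lebesgue_on {0<..<T}"] X by simp
  then show False
    using ab by (simp add: emeasure_lebesgue_on_Ioo)
qed

text \<open>For \<open>\<tau> > 0\<close> and \<open>t > 0\<close> this is the k with (k-1)\<tau> <
  t <= k\<tau>; the ceiling fits intervals that are closed on the right. Times t <= 0 get index 0,
  before the first step.\<close>

definition step_index :: "real \<Rightarrow> real \<Rightarrow> nat" where
  "step_index \<tau> t = nat \<lceil>t / \<tau>\<rceil>"

lemma step_index_mono: "\<tau> > 0 \<Longrightarrow> s \<le> t \<Longrightarrow> step_index \<tau> s \<le> step_index \<tau> t"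
  unfolding step_index_def by (intro nat_mono ceiling_mono divide_right_mono) auto

lemma step_index_eqI:
  assumes "\<tau> > 0" "k \<ge> 1" "(real k - 1) * \<tau> < t" "t \<le> real k * \<tau>"
  shows "step_index \<tau> t = k"
proof -
  have "\<lceil>t / \<tau>\<rceil> = int k"
    using assms by (intro ceiling_unique) (auto simp: field_simps)
  then show ?thesis
    by (simp add: step_index_def)
qed

lemma step_index_bounds:
  assumes "\<tau> > 0" "t > 0"
  shows "step_index \<tau> t \<ge> 1" "(real (step_index \<tau> t) - 1) * \<tau> < t" "t \<le> real (step_index \<tau> t) * \<tau>"
proof -
  have ge: "\<lceil>t / \<tau>\<rceil> \<ge> 1"
    using assms by (simp add: Int.int_one_le_iff_zero_less)
  then show "step_index \<tau> t \<ge> 1"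
    unfolding step_index_def by linarith
  have eq: "real (step_index \<tau> t) = of_int \<lceil>t / \<tau>\<rceil>"
    unfolding step_index_def using ge by linarith
  have "of_int \<lceil>t / \<tau>\<rceil> - 1 < t / \<tau>" "t / \<tau> \<le> of_int \<lceil>t / \<tau>\<rceil>"
    by linarith+
  then show "(real (step_index \<tau> t) - 1) * \<tau> < t" "t \<le> real (step_index \<tau> t) * \<tau>"
    unfolding eq using assms(1) by (simp_all only: pos_less_divide_eq pos_divide_le_eq)
qed

lemma step_index_measurable [measurable]: "step_index \<tau> \<in> borel \<rightarrow>\<^sub>M count_space UNIV"
  unfolding step_index_def by measurable

text \<open>The sum of indicators lies below g at every point, so monotonicity of the integral
  applies to shifted differences without a measurability proof. Only the open intervals enter, where
  shifted values are known.\<close>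

lemma nn_integral_steps_ge:
  fixes c :: "nat \<Rightarrow> real"
  assumes \<tau>: "\<tau> > 0" and c: "\<And>k. c k \<ge> 0"
    and g: "\<And>k t. 1 \<le> k \<Longrightarrow> k \<le> m \<Longrightarrow> (real k - 1) * \<tau> < t \<Longrightarrow> t < real k * \<tau> \<Longrightarrow> g t = c k"
  shows "ennreal (\<Sum>k=1..m. c k * \<tau>) \<le> (\<integral>\<^sup>+ t. ennreal (g t) \<partial>lebesgue_on {0<..<real m * \<tau>})"
proof -
  let ?A = "lebesgue_on {0<..<real m * \<tau>}"
  define I where "I k = {(real k - 1) * \<tau><..<real k * \<tau>}" for k
  have I: "emeasure ?A (I k) = ennreal \<tau>" "I k \<in> sets ?A" if "k \<in> {1..m}" for k
  proof -
    have "real k * \<tau> \<le> real m * \<tau>" "0 \<le> (real k - 1) * \<tau>"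
      using that \<tau> by (auto intro: mult_right_mono)
    then show "emeasure ?A (I k) = ennreal \<tau>"
      unfolding I_def using \<tau> by (subst emeasure_lebesgue_on_Ioo) (auto simp: algebra_simps)
    have "I k \<subseteq> {0<..<real m * \<tau>}"
      using \<open>real k * \<tau> \<le> real m * \<tau>\<close> \<open>0 \<le> (real k - 1) * \<tau>\<close> by (auto simp: I_def)
    then show "I k \<in> sets ?A"
      by (subst sets_restrict_space_iff) (auto simp: I_def)
  qed
  have "ennreal (\<Sum>k=1..m. c k * \<tau>) = (\<Sum>k=1..m. ennreal (c k) * emeasure ?A (I k))"
    using I(1) c \<tau> by (subst sum_ennreal[symmetric]) (auto simp: ennreal_mult intro!: sum.cong)
  also have "\<dots> = (\<integral>\<^sup>+ t. (\<Sum>k=1..m. ennreal (c k) * indicator (I k) t) \<partial>?A)"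
    using I(2) by (subst nn_integral_sum) (auto intro!: sum.cong nn_integral_cmult_indicator[symmetric])
  also have "\<dots> \<le> (\<integral>\<^sup>+ t. ennreal (g t) \<partial>?A)"
  proof (rule nn_integral_mono)
    fix t
    show "(\<Sum>k=1..m. ennreal (c k) * indicator (I k) t) \<le> ennreal (g t)"
    proof (cases "\<exists>k\<in>{1..m}. t \<in> I k")
      case True
      then obtain k where k: "k \<in> {1..m}" "t \<in> I k" by blast
      have "indicator (I j) t = (if j = k then 1 else 0 :: ennreal)" if "j \<in> {1..m}" for j
      proof (cases "t \<in> I j")
        case True
        then have "step_index \<tau> t = j" "step_index \<tau> t = k"
          using k that \<tau> by (auto intro!: step_index_eqI simp: I_def)
        then show ?thesis using True by simp
      qed (use k in auto)
      then have "(\<Sum>j=1..m. ennreal (c j) * indicator (I j) t)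
          = (\<Sum>j=1..m. if j = k then ennreal (c j) else 0)"
        by (intro sum.cong) auto
      also have "\<dots> = ennreal (c k)"
        using k by simp
      also have "c k = g t"
        using g[of k t] k by (auto simp: I_def)
      finally show ?thesis by simp
    next
      case False
      then have "(\<Sum>k=1..m. ennreal (c k) * indicator (I k) t) = 0"
        by (intro sum.neutral) auto
      then show ?thesis by simp
    qed
  qed
  finally show ?thesis .
qed

section \<open>From bounds on time shifts to sums of jumps and their variation\<close>

lemma Lp_norm_le_imp_nn_integral_le:
  assumes p: "1 \<le> p" "p < \<infinity>" and le: "Lp_norm p T g \<le> ennreal K" "K \<ge> 0"
  shows "(\<integral>\<^sup>+ t. ennreal (\<bar>g t\<bar> powr enn2real p) \<partial>lebesgue_on {0<..<T}) \<le> ennreal (K powr enn2real p)"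
proof -
  define I where "I = (\<integral>\<^sup>+ t. ennreal (\<bar>g t\<bar> powr enn2real p) \<partial>lebesgue_on {0<..<T})"
  have *: "(if I = \<infinity> then \<infinity> else ennreal (enn2real I powr (1 / enn2real p))) \<le> ennreal K"
    using le(1) p(2) by (simp add: Lp_norm_def I_def[symmetric] Let_def split: if_splits)
  then have fin: "I \<noteq> \<infinity>"
    by (auto simp: top_unique)
  then have "enn2real I powr (1 / enn2real p) \<le> K"
    using * le(2) by simp
  then have "(enn2real I powr (1 / enn2real p)) powr enn2real p \<le> K powr enn2real p"
    using enn2real_ge_1[OF p] by (intro powr_mono2) auto
  then have "enn2real I \<le> K powr enn2real p"
    using enn2real_ge_1[OF p] by (simp add: powr_powr)
  then have "ennreal (enn2real I) \<le> ennreal (K powr enn2real p)"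
    by (rule ennreal_leI)
  then show ?thesis
    using fin by (simp add: I_def[symmetric] ennreal_enn2real_if)
qed

text \<open>A threshold argument in place of Hoelder's inequality: a jump d is either at most
  \<open>l * \<tau>\<close>, or d = d^(1-r) d^r <= (l \<tau>)^(1-r) d^r because 1 - r < 0. The right
  side (C \<tau>)^r of \<open>le\<close> is the shape given by the time-shift bound, and all powers
  of \<open>\<tau>\<close> cancel. The threshold l remains free: a large l makes the second term
  small at the price of a steep linear one.\<close>

lemma sum_le_of_powr_sum:
  fixes d :: "'i \<Rightarrow> real"
  assumes S: "finite S" "\<And>k. k \<in> S \<Longrightarrow> d k \<ge> 0" and r: "r > 1" and pos: "\<tau> > 0" "l > 0" "C > 0"
    and le: "(\<Sum>k\<in>S. d k powr r * \<tau>) \<le> (C * \<tau>) powr r"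
  shows "(\<Sum>k\<in>S. d k) \<le> l * (real (card S) * \<tau>) + l powr (1 - r) * C powr r"
proof -
  have term_le: "x \<le> l * \<tau> + l powr (1 - r) * \<tau> powr (- r) * (x powr r * \<tau>)" if "x \<ge> 0" for x
  proof (cases "x \<le> l * \<tau>")
    case True
    then show ?thesis
      using pos by (auto intro: order_trans)
  next
    case False
    then have x: "x > l * \<tau>" "x > 0"
      using pos by (auto intro: less_trans[of 0 "l * \<tau>"])
    have "x = x powr (1 - r) * x powr r"
      using x by (simp flip: powr_add)
    also have "\<dots> \<le> (l * \<tau>) powr (1 - r) * x powr r"
      using x r pos by (intro mult_right_mono powr_mono2') auto
    also have "\<dots> = l powr (1 - r) * \<tau> powr (- r) * (x powr r * \<tau>)"
    proof -
      have "\<tau> powr (1 - r) = \<tau> powr (- r) * \<tau>"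
        using pos powr_add[of \<tau> "-r" 1] by (simp add: add.commute)
      then show ?thesis
        using pos by (simp add: powr_mult)
    qed
    finally show ?thesis
      using pos by (simp add: add_increasing)
  qed
  have "(\<Sum>k\<in>S. d k) \<le> (\<Sum>k\<in>S. l * \<tau> + l powr (1 - r) * \<tau> powr (- r) * (d k powr r * \<tau>))"
    using S by (intro sum_mono term_le) auto
  also have "\<dots> = l * (real (card S) * \<tau>) + l powr (1 - r) * \<tau> powr (- r) * (\<Sum>k\<in>S. d k powr r * \<tau>)"
    by (simp add: sum.distrib sum_distrib_left)
  also have "\<dots> \<le> l * (real (card S) * \<tau>) + l powr (1 - r) * \<tau> powr (- r) * (C * \<tau>) powr r"
    using le by (intro add_left_mono mult_left_mono) auto
  also have "l powr (1 - r) * \<tau> powr (- r) * (C * \<tau>) powr r = l powr (1 - r) * C powr r"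
    using pos by (simp add: powr_mult powr_minus field_simps)
  finally show ?thesis by simp
qed

text \<open>The total variation up to time t of the step function with values b 1, ..., b N. The
  \<open>min\<close> freezes it after the last step, so that it is monotone and bounded on the whole
  line and no value beyond b N is met.\<close>

definition step_variation :: "real \<Rightarrow> nat \<Rightarrow> (nat \<Rightarrow> 'y::real_normed_vector) \<Rightarrow> real \<Rightarrow> real" where
  "step_variation \<tau> N b t = (\<Sum>k=1..<min (step_index \<tau> t) N. norm (b (Suc k) - b k))"

lemma mono_step_variation:
  assumes "\<tau> > 0"
  shows "mono (step_variation \<tau> N b)"
proof (rule monoI)
  fix s t :: real assume "s \<le> t"
  then have "step_index \<tau> s \<le> step_index \<tau> t"
    by (rule step_index_mono[OF assms])
  then show "step_variation \<tau> N b s \<le> step_variation \<tau> N b t"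
    unfolding step_variation_def by (intro sum_mono2) auto
qed

lemma step_variation_bounds:
  "0 \<le> step_variation \<tau> N b t" "step_variation \<tau> N b t \<le> (\<Sum>k=1..<N. norm (b (Suc k) - b k))"
  unfolding step_variation_def by (auto intro!: sum_nonneg sum_mono2)

lemma step_variation_diff:
  assumes "step_index \<tau> s \<ge> 1" "step_index \<tau> s \<le> step_index \<tau> t" "step_index \<tau> t \<le> N"
  shows "step_variation \<tau> N b t - step_variation \<tau> N b s
    = (\<Sum>k=step_index \<tau> s..<step_index \<tau> t. norm (b (Suc k) - b k))"
  using assms sum.atLeastLessThan_concat[of 1 "step_index \<tau> s" "step_index \<tau> t" "\<lambda>k. norm (b (Suc k) - b k)"]
  unfolding step_variation_def by (simp add: min_absorb1)

lemma norm_diff_le_step_variation: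
  assumes "step_index \<tau> s \<ge> 1" "step_index \<tau> s \<le> step_index \<tau> t" "step_index \<tau> t \<le> N"
  shows "norm (b (step_index \<tau> t) - b (step_index \<tau> s)) \<le> step_variation \<tau> N b t - step_variation \<tau> N b s"
proof -
  have "b (step_index \<tau> t) - b (step_index \<tau> s) = (\<Sum>k=step_index \<tau> s..<step_index \<tau> t. b (Suc k) - b k)"
    using assms(2) by (rule sum_Suc_diff'[symmetric])
  then show ?thesis
    unfolding step_variation_diff[OF assms] by (simp add: norm_sum)
qed

locale step_function =
  fixes T \<tau> :: real and N :: nat and u :: "real \<Rightarrow> 'b::real_normed_vector"
  assumes T: "T > 0" and N: "N \<ge> 1" and \<tau>_eq: "\<tau> = T / real N"
    and const: "\<And>k. 1 \<le> k \<Longrightarrow> k \<le> N \<Longrightarrow>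
      u constant_on ({(real k - 1) * \<tau> <.. real k * \<tau>} \<inter> {0<..<T})"
begin

text \<open>The value is read at the midpoint because for k = N the right end point is T, outside
  the open interval on which u is known.\<close>

definition val :: "nat \<Rightarrow> 'b" where
  "val k = u ((real k - 1 / 2) * \<tau>)"

lemma \<tau>_pos: "\<tau> > 0"
  using T N by (simp add: \<tau>_eq)

lemma N_\<tau>: "real N * \<tau> = T"
  using N by (simp add: \<tau>_eq)

lemma interval_le_T: "k \<le> N \<Longrightarrow> real k * \<tau> \<le> T"
  using \<tau>_pos N_\<tau> mult_right_mono[of "real k" "real N" \<tau>] by simp

lemma step_index_le_N:
  assumes "t \<in> {0<..<T}"
  shows "step_index \<tau> t \<le> N"
proof -
  have "step_index \<tau> T = N"
    using N \<tau>_pos N_\<tau> by (intro step_index_eqI) (auto simp: algebra_simps)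
  then show ?thesis
    using step_index_mono[OF \<tau>_pos, of t T] assms by simp
qed

lemma step_index_ge_1:
  assumes "t \<in> {0<..<T}"
  shows "step_index \<tau> t \<ge> 1"
  using step_index_bounds(1)[OF \<tau>_pos] assms by simp

lemma val_step_index:
  assumes t: "t \<in> {0<..<T}"
  shows "u t = val (step_index \<tau> t)"
proof -
  define k where "k = step_index \<tau> t"
  have k: "k \<ge> 1" "k \<le> N" "(real k - 1) * \<tau> < t" "t \<le> real k * \<tau>"
    using step_index_bounds[OF \<tau>_pos] step_index_le_N[OF t] t by (auto simp: k_def)
  have "(real k - 1) * \<tau> \<ge> 0"
    using k \<tau>_pos by simp
  then have "(real k - 1 / 2) * \<tau> \<in> {(real k - 1) * \<tau> <.. real k * \<tau>} \<inter> {0<..<T}"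
    using interval_le_T[OF k(2)] \<tau>_pos by (auto simp: algebra_simps)
  moreover have "t \<in> {(real k - 1) * \<tau> <.. real k * \<tau>} \<inter> {0<..<T}"
    using k t by auto
  ultimately show ?thesis
    using const[OF k(1,2)] unfolding constant_on_def val_def k_def[symmetric] by metis
qed

text \<open>Each step has positive length, so a property valid almost everywhere holds at some point
  of it, and by constancy on all of it. Null sets disappear from here on.\<close>

lemma all_of_AE:
  assumes AE: "AE t in lebesgue_on {0<..<T}. Q (u t)" and t: "t \<in> {0<..<T}"
  shows "Q (u t)"
proof -
  define k where "k = step_index \<tau> t"
  have k: "k \<ge> 1" "k \<le> N"
    using step_index_bounds[OF \<tau>_pos] step_index_le_N[OF t] t by (auto simp: k_def)
  have nn: "(real k - 1) * \<tau> \<ge> 0"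
    using k \<tau>_pos by simp
  have "(real k - 1) * \<tau> < real k * \<tau>"
    using \<tau>_pos by simp
  then obtain t' where t': "t' \<in> {(real k - 1) * \<tau><..<real k * \<tau>}" "Q (u t')"
    using AE_lebesgue_on_ex[OF AE nn _ interval_le_T[OF k(2)]] by blast
  have "step_index \<tau> t' = k"
    using t' k \<tau>_pos by (intro step_index_eqI) auto
  moreover have "t' \<in> {0<..<T}"
    using t' nn interval_le_T[OF k(2)] by auto
  ultimately show ?thesis
    using t' val_step_index[OF t] val_step_index[of t'] by (simp add: k_def)
qed

lemma simple: "simple_function (lebesgue_on {0<..<T}) u"
proof -
  have "simple_function (lebesgue_on {0<..<T}) (step_index \<tau>)"
    unfolding simple_function_def
  proof (intro conjI ballI)
    show "finite (step_index \<tau> ` space (lebesgue_on {0<..<T}))"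
      by (rule finite_subset[of _ "{..N}"]) (use step_index_le_N in auto)
    fix k
    have "step_index \<tau> -` {k} \<in> sets borel"
      using measurable_sets[OF step_index_measurable, of "{k}"] by simp
    then show "step_index \<tau> -` {k} \<inter> space (lebesgue_on {0<..<T}) \<in> sets (lebesgue_on {0<..<T})"
      by (subst sets_restrict_space_iff) auto
  qed
  then have "simple_function (lebesgue_on {0<..<T}) (\<lambda>t. val (step_index \<tau> t))"
    by (rule simple_function_compose1)
  then show ?thesis
    using val_step_index by (subst simple_function_cong) auto
qed

text \<open>The shift by \<open>\<tau>\<close> carries the interior of step k into step k + 1. The
  right end point is excluded since for k = N - 1 its shift is T.\<close>

lemma jump:
  assumes k: "1 \<le> k" "k \<le> N - 1" and t: "(real k - 1) * \<tau> < t" "t < real k * \<tau>"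
  shows "u (t + \<tau>) - u t = val (Suc k) - val k"
    and "t \<in> {0<..<T}" "t + \<tau> \<in> {0<..<T}"
proof -
  have "(real k - 1) * \<tau> \<ge> 0" "real (Suc k) * \<tau> \<le> T"
    using k \<tau>_pos interval_le_T[of "Suc k"] by auto
  moreover have "t + \<tau> < real (Suc k) * \<tau>"
    using t by (simp add: algebra_simps)
  ultimately have "0 < t" "t + \<tau> < T"
    using t by linarith+
  then show t': "t \<in> {0<..<T}" "t + \<tau> \<in> {0<..<T}"
    using \<tau>_pos by auto
  have "step_index \<tau> t = k" "step_index \<tau> (t + \<tau>) = Suc k"
    using t k \<tau>_pos by (auto intro!: step_index_eqI simp: algebra_simps)
  then show "u (t + \<tau>) - u t = val (Suc k) - val k"
    using val_step_index[OF t'(1)] val_step_index[OF t'(2)] by simp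
qed

lemma T_minus_\<tau>: "T - \<tau> = real (N - 1) * \<tau>"
  using N N_\<tau> by (simp add: of_nat_diff algebra_simps)

lemma all_val:
  assumes "\<And>t. t \<in> {0<..<T} \<Longrightarrow> P (u t)" "1 \<le> k" "k \<le> N"
  shows "P (val k)"
proof -
  have "(real k - 1) * \<tau> \<ge> 0" "real k * \<tau> \<le> T"
    using assms \<tau>_pos by (auto intro: interval_le_T)
  then have "(real k - 1 / 2) * \<tau> \<in> {0<..<T}"
    using \<tau>_pos by (auto simp: algebra_simps)
  then show ?thesis
    unfolding val_def by (rule assms(1))
qed

text \<open>Inside the steps that fill (0, T - \<tau>), the shifted difference takes exactly the N -
  1 jumps as values, each over a length \<open>\<tau>\<close>. The map \<open>J\<close> stands for
  the passage to Y and acts on the difference, as in the time-shift assumption.\<close>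

lemma jump_powr_sum_le:
  fixes J :: "'b \<Rightarrow> 'y::real_normed_vector"
  assumes r: "1 \<le> r" "r < \<infinity>" and K: "K \<ge> 0"
    and le: "Lp_norm r (T - \<tau>) (\<lambda>t. norm (J (u (t + \<tau>) - u t))) \<le> ennreal K"
  shows "(\<Sum>k=1..<N. norm (J (val (Suc k) - val k)) powr enn2real r * \<tau>) \<le> K powr enn2real r"
proof -
  have "ennreal (\<Sum>k=1..N-1. norm (J (val (Suc k) - val k)) powr enn2real r * \<tau>) \<le>
      (\<integral>\<^sup>+ t. ennreal (norm (J (u (t + \<tau>) - u t)) powr enn2real r) \<partial>lebesgue_on {0<..<real (N - 1) * \<tau>})"
    by (rule nn_integral_steps_ge[OF \<tau>_pos]) (auto simp: jump(1))
  also have "\<dots> \<le> ennreal (K powr enn2real r)"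
    using Lp_norm_le_imp_nn_integral_le[OF r le K] by (simp add: T_minus_\<tau>)
  finally have "(\<Sum>k=1..N-1. norm (J (val (Suc k) - val k)) powr enn2real r * \<tau>) \<le> K powr enn2real r"
    by (simp add: ennreal_le_iff)
  moreover have "{1..<N} = {1..N-1}"
    using N by auto
  ultimately show ?thesis by simp
qed

lemma jump_le_esssup:
  fixes J :: "'b \<Rightarrow> 'y::real_normed_vector"
  assumes K: "K \<ge> 0" and k: "1 \<le> k" "k \<le> N - 1"
    and le: "Lp_norm \<infinity> (T - \<tau>) (\<lambda>t. norm (J (u (t + \<tau>) - u t))) \<le> ennreal K"
  shows "norm (J (val (Suc k) - val k)) \<le> K"
proof -
  have "AE t in lebesgue_on {0<..<T - \<tau>}. ennreal \<bar>norm (J (u (t + \<tau>) - u t))\<bar> \<le>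
      esssup (lebesgue_on {0<..<T - \<tau>}) (\<lambda>t. ennreal \<bar>norm (J (u (t + \<tau>) - u t))\<bar>)"
    by (rule esssup_AE)
  then have "AE t in lebesgue_on {0<..<T - \<tau>}. norm (J (u (t + \<tau>) - u t)) \<le> K"
    by eventually_elim (use le K in \<open>auto simp: Lp_norm_def dest: order_trans\<close>)
  moreover have "0 \<le> (real k - 1) * \<tau>" "(real k - 1) * \<tau> < real k * \<tau>" "real k * \<tau> \<le> T - \<tau>"
    using k \<tau>_pos unfolding T_minus_\<tau> by (auto simp: of_nat_diff intro!: mult_right_mono)
  ultimately obtain t where "(real k - 1) * \<tau> < t" "t < real k * \<tau>" "norm (J (u (t + \<tau>) - u t)) \<le> K"
    by (meson AE_lebesgue_on_ex greaterThanLessThan_iff)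
  then show ?thesis
    using jump(1)[OF k] by simp
qed

end

section \<open>Relative compactness for finite exponents\<close>

text \<open>With s the whole sum, each x^p is at most s^(p-1) x. This turns a bound on the total
  variation into one on the p-th powers of its increments.\<close>

lemma sum_powr_le_powr_sum:
  fixes x :: "'i \<Rightarrow> real"
  assumes S: "finite S" "\<And>k. k \<in> S \<Longrightarrow> x k \<ge> 0" and p: "p \<ge> 1"
  shows "(\<Sum>k\<in>S. x k powr p) \<le> (\<Sum>k\<in>S. x k) powr p"
proof -
  define s where "s = (\<Sum>k\<in>S. x k)"
  have le: "x k powr p \<le> s powr (p - 1) * x k" if "k \<in> S" for k
  proof (cases "x k = 0")
    case False
    have "x k \<le> s"
      using member_le_sum[of k S x] S that by (auto simp: s_def)
    have "x k powr p = x k powr (p - 1) * x k"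
      using False S(2)[OF that] by (simp add: powr_diff)
    also have "\<dots> \<le> s powr (p - 1) * x k"
      using S that p \<open>x k \<le> s\<close> by (intro mult_right_mono powr_mono2) auto
    finally show ?thesis .
  qed simp
  have s: "s \<ge> 0"
    using S by (auto simp: s_def intro: sum_nonneg)
  have "(\<Sum>k\<in>S. x k powr p) \<le> (\<Sum>k\<in>S. s powr (p - 1) * x k)"
    by (rule sum_mono) (rule le)
  also have "\<dots> = s powr (p - 1) * s"
    by (simp add: s_def sum_distrib_left)
  also have "\<dots> = s powr p"
    using s by (cases "s = 0") (auto simp: powr_diff)
  finally show ?thesis
    by (simp add: s_def)
qed

lemma powr_add5_le:
  fixes a b c d e p :: real
  assumes "a \<ge> 0" "b \<ge> 0" "c \<ge> 0" "d \<ge> 0" "e \<ge> 0" "p \<ge> 0"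
  shows "(a + b + c + d + e) powr p \<le> 5 powr p * (a powr p + b powr p + c powr p + d powr p + e powr p)"
proof -
  define m where "m = Max {a, b, c, d, e}"
  have le: "a \<le> m" "b \<le> m" "c \<le> m" "d \<le> m" "e \<le> m"
    unfolding m_def by auto
  have "m \<in> {a, b, c, d, e}"
    unfolding m_def by (rule Max_in) auto
  then have "m powr p \<le> a powr p + b powr p + c powr p + d powr p + e powr p"
    by (auto simp: add_nonneg_nonneg add_increasing add_increasing2)
  moreover have "(a + b + c + d + e) powr p \<le> (5 * m) powr p"
    using assms le by (intro powr_mono2) auto
  moreover have "(5 * m) powr p = 5 powr p * m powr p"
    by (rule powr_mult)
  ultimately show ?thesis
    by (metis mult_left_mono order_trans powr_ge_zero)
qed

lemma ex_small_powr:
  fixes A e p :: real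
  assumes "A \<ge> 0" "e > 0" "p > 0"
  shows "\<exists>x>0. A * x powr p \<le> e"
proof -
  \<comment> \<open>The witness solves (A + 1) x^p = e; the 1 covers A = 0.\<close>
  have "A * ((e / (A + 1)) powr (1 / p)) powr p = A * e / (A + 1)"
    using assms by (simp add: powr_powr)
  also have "\<dots> \<le> e"
    using assms by (simp add: field_simps)
  finally show ?thesis
    using assms by (intro exI[of _ "(e / (A + 1)) powr (1 / p)"]) auto
qed

lemma Lp_fun_bounded:
  fixes f :: "real \<Rightarrow> 'b::real_normed_vector"
  assumes p: "1 \<le> p" "p < \<infinity>" and T: "T > 0"
    and f: "strongly_measurable (lebesgue_on {0<..<T}) f" "\<And>t. t \<in> {0<..<T} \<Longrightarrow> norm (f t) \<le> B"
  shows "f \<in> Lp_fun p T"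
proof -
  have "powr_nn_integral (lebesgue_on {0<..<T}) (enn2real p) f
      \<le> (\<integral>\<^sup>+ t. ennreal (B powr enn2real p) \<partial>lebesgue_on {0<..<T})"
    unfolding powr_nn_integral_def using enn2real_ge_1[OF p] f(2)
    by (intro nn_integral_mono ennreal_leI powr_mono2) auto
  also have "\<dots> = ennreal (B powr enn2real p) * ennreal T"
    using emeasure_lebesgue_on_Ioo[of 0 T T] T by simp
  also have "\<dots> < \<infinity>"
    by (simp flip: ennreal_mult')
  finally show ?thesis
    using f(1) by (simp add: Lp_fun_iff[OF p(2)])
qed

lemma nn_integral_partition_le:
  fixes D :: "nat \<Rightarrow> real"
  assumes h: "h > 0" and D: "\<And>k. D k \<ge> 0"
  shows "(\<integral>\<^sup>+ t. (\<Sum>k=1..m. ennreal (D k) * indicator ({(real k - 1) * h<..real k * h} \<inter> {0<..<T}) t)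
      \<partial>lebesgue_on {0<..<T}) \<le> ennreal ((\<Sum>k=1..m. D k) * h)"
proof -
  let ?A = "lebesgue_on {0<..<T}"
  define J where "J k = {(real k - 1) * h<..real k * h} \<inter> {0<..<T}" for k
  have J: "J k \<in> sets ?A" for k
    by (subst sets_restrict_space_iff) (auto simp: J_def)
  have "emeasure ?A (J k) \<le> ennreal h" for k
  proof -
    have "emeasure ?A (J k) = emeasure lebesgue (J k)"
      by (subst emeasure_restrict_space) (auto simp: J_def)
    also have "\<dots> \<le> emeasure lebesgue {(real k - 1) * h<..real k * h}"
      by (intro emeasure_mono) (auto simp: J_def)
    also have "\<dots> = ennreal h"
      using h by (subst emeasure_completion) (auto simp: algebra_simps)
    finally show ?thesis .
  qed
  then have "(\<Sum>k=1..m. ennreal (D k) * emeasure ?A (J k)) \<le> (\<Sum>k=1..m. ennreal (D k) * ennreal h)"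
    by (intro sum_mono mult_left_mono) auto
  also have "\<dots> = ennreal ((\<Sum>k=1..m. D k) * h)"
    using D h by (simp add: sum_distrib_right sum_nonneg flip: ennreal_mult sum_ennreal)
  finally have "(\<Sum>k=1..m. ennreal (D k) * emeasure ?A (J k)) \<le> ennreal ((\<Sum>k=1..m. D k) * h)" .
  moreover have "(\<integral>\<^sup>+ t. (\<Sum>k=1..m. ennreal (D k) * indicator (J k) t) \<partial>?A)
      = (\<Sum>k=1..m. ennreal (D k) * emeasure ?A (J k))"
    using J by (subst nn_integral_sum) (auto intro!: sum.cong nn_integral_cmult_indicator)
  ultimately show ?thesis
    by (simp add: J_def)
qed

lemma ex_minimizer_finite_range:
  fixes g :: "'a \<Rightarrow> real"
  assumes "finite (g ` J)" "J \<noteq> {}"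
  shows "\<exists>x\<in>J. \<forall>t\<in>J. g x \<le> g t"
proof -
  have "Min (g ` J) \<in> g ` J"
    using assms by (intro Min_in) auto
  then obtain x where "x \<in> J" "g x = Min (g ` J)"
    by auto
  then show ?thesis
    using assms(1) by (intro bexI[of _ x]) auto
qed

text \<open>The space Y has been eliminated: what is left of it is the monotone \<open>V n\<close>
  between 0 and a common C, and the Ehrling inequality \<open>ehr\<close> with its constant uniform
  in n.\<close>

lemma Lp_precompact:
  fixes u :: "nat \<Rightarrow> real \<Rightarrow> 'b::banach" and V :: "nat \<Rightarrow> real \<Rightarrow> real"
  assumes T: "T > 0" and p: "p \<ge> 1" and K: "K \<ge> 0"
    and simple: "\<And>n. simple_function (lebesgue_on {0<..<T}) (u n)"
    and M: "\<And>n t. t \<in> {0<..<T} \<Longrightarrow> u n t \<in> M"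
    and sn: "\<And>x. x \<in> M \<Longrightarrow> sn x \<ge> 0"
    and cpt: "compactly_embedded M sn"
    and V: "\<And>n. mono (V n)" "\<And>n t. 0 \<le> V n t" "\<And>n t. V n t \<le> C"
    and ehr: "\<And>\<epsilon>. \<epsilon> > 0 \<Longrightarrow> \<exists>c\<ge>0. \<forall>n. \<forall>s\<in>{0<..<T}. \<forall>t\<in>{0<..<T}.
      norm (u n t - u n s) \<le> \<epsilon> * (sn (u n t) + sn (u n s)) + c * \<bar>V n t - V n s\<bar>"
    and bound: "\<And>n. (\<integral>\<^sup>+ t. ennreal (sn (u n t) powr p) \<partial>lebesgue_on {0<..<T}) \<le> ennreal K"
  shows "\<exists>s g. strict_mono (s :: nat \<Rightarrow> nat) \<and> strongly_measurable (lebesgue_on {0<..<T}) g \<and>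
    (\<lambda>n. powr_nn_integral (lebesgue_on {0<..<T}) p (\<lambda>t. u (s n) t - g t)) \<longlonglongrightarrow> 0"
proof -
  let ?A = "lebesgue_on {0<..<T}"
  define h where "h m = T / real (Suc m)" for m
  have h: "h m > 0" "real (Suc m) * h m = T" for m
    using T by (auto simp: h_def)
  define J where "J m k = {(real k - 1) * h m<..real k * h m} \<inter> {0<..<T}" for m k
  have cover: "step_index (h m) t \<in> {1..Suc m}" "t \<in> J m (step_index (h m) t)"
    if t: "t \<in> {0<..<T}" for m t
  proof -
    have "step_index (h m) T = Suc m"
      using h[of m] by (intro step_index_eqI) (auto simp: algebra_simps)
    then show "step_index (h m) t \<in> {1..Suc m}"
      using step_index_bounds(1)[OF h(1), of t m] step_index_mono[OF h(1), of t T m] t by auto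
    show "t \<in> J m (step_index (h m) t)"
      using step_index_bounds(2,3)[OF h(1), of t m] t by (auto simp: J_def)
  qed
  have Ioo: "0 \<le> (real k - 1) * h m" "real k * h m \<le> T" if "k \<in> {1..Suc m}" for m k
  proof -
    show "0 \<le> (real k - 1) * h m"
      using that h(1)[of m] by simp
    have "real k * h m \<le> real (Suc m) * h m"
      using that h(1)[of m] by (intro mult_right_mono) auto
    then show "real k * h m \<le> T"
      by (simp only: h)
  qed
  have ex_min: "\<exists>x\<in>J m k. \<forall>t\<in>J m k. sn (u n x) \<le> sn (u n t)" if k: "k \<in> {1..Suc m}" for n m k
  proof (rule ex_minimizer_finite_range)
    have "finite (sn ` u n ` {0<..<T})"
      using simple_functionD(1)[OF simple[of n]] by simp
    then show "finite ((\<lambda>t. sn (u n t)) ` J m k)"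
      by (rule finite_subset[rotated]) (auto simp: J_def)
    have "(real k - 1 / 2) * h m \<in> J m k"
      using Ioo[OF k] h(1)[of m] by (auto simp: J_def algebra_simps)
    then show "J m k \<noteq> {}" by blast
  qed
  define x where "x n m k = (SOME x. x \<in> J m k \<and> (\<forall>t\<in>J m k. sn (u n x) \<le> sn (u n t)))" for n m k
  have x_min: "x n m k \<in> J m k \<and> (\<forall>t\<in>J m k. sn (u n (x n m k)) \<le> sn (u n t))"
    if "k \<in> {1..Suc m}" for n m k
    unfolding x_def by (rule someI_ex) (use ex_min[OF that, of n] in blast)
  note x = x_min[THEN conjunct1] and min = x_min[THEN conjunct2, rule_format]
  have x_in: "x n m k \<in> {0<..<T}" if "k \<in> {1..Suc m}" for n m k
    using x[OF that] by (auto simp: J_def)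
  \<comment> \<open>The minimum lies below every value on an interval of length \<open>h m\<close>,
    so y^p h <= K.\<close>
  have sn_x: "sn (u n (x n m k)) \<le> (K / h m) powr (1 / p)" if k: "k \<in> {1..Suc m}" for n m k
  proof -
    define y where "y = sn (u n (x n m k))"
    define I where "I = {(real k - 1) * h m<..<real k * h m}"
    have y: "y \<ge> 0"
      unfolding y_def by (intro sn M x_in k)
    have I: "I \<subseteq> {0<..<T}" "I \<subseteq> J m k"
      using Ioo[OF k] by (auto simp: I_def J_def)
    have "ennreal (y powr p) * ennreal (h m) = ennreal (y powr p) * emeasure ?A I"
      unfolding I_def using Ioo[OF k] h(1)[of m]
      by (subst emeasure_lebesgue_on_Ioo) (auto simp: algebra_simps)
    also have "\<dots> = (\<integral>\<^sup>+ t. ennreal (y powr p) * indicator I t \<partial>?A)"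
      using I(1) by (intro nn_integral_cmult_indicator[symmetric]) 
        (subst sets_restrict_space_iff, auto simp: I_def)
    also have "\<dots> \<le> (\<integral>\<^sup>+ t. ennreal (sn (u n t) powr p) \<partial>?A)"
      using min[OF k] I(2) y p
      by (intro nn_integral_mono) (auto simp: indicator_def y_def intro!: ennreal_leI powr_mono2)
    also have "\<dots> \<le> ennreal K"
      by (rule bound)
    finally have "y powr p * h m \<le> K"
      using K h(1)[of m] by (simp flip: ennreal_mult)
    then have "(y powr p) powr (1 / p) \<le> (K / h m) powr (1 / p)"
      using h(1)[of m] p by (intro powr_mono2) (auto simp: field_simps)
    then show ?thesis
      using p y by (simp add: powr_powr y_def)
  qed
  \<comment> \<open>Partition m and interval k are coded as one index, so that a single subsequence
    converges at the samples of all partitions; m is fixed only later, in terms of the accuracy e.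
    Pairs that denote no interval get the constant 0.\<close>
  define a where "a n i = (case prod_decode i of (m, k) \<Rightarrow> if k \<in> {1..Suc m} then u n (x n m k) else 0)" for n i
  have "\<exists>s. strict_mono (s :: nat \<Rightarrow> nat) \<and> (\<forall>i. convergent (\<lambda>n. a (s n) i))"
  proof (rule diagonal_convergent_subseq)
    fix i and s :: "nat \<Rightarrow> nat"
    obtain m k where mk: "prod_decode i = (m, k)" by fastforce
    show "\<exists>r. strict_mono (r :: nat \<Rightarrow> nat) \<and> convergent (\<lambda>n. a (s (r n)) i)"
    proof (cases "k \<in> {1..Suc m}")
      case True
      obtain r where "strict_mono (r :: nat \<Rightarrow> nat)" "convergent (\<lambda>n. u (s (r n)) (x (s (r n)) m k))"
        by (rule compactly_embeddedD[OF cpt, of "\<lambda>n. u (s n) (x (s n) m k)" "(K / h m) powr (1 / p)"])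
          (use M x_in sn_x True in auto)
      then show ?thesis
        using True by (auto simp: a_def mk)
    next
      case False
      then show ?thesis
        by (intro exI[of _ id]) (auto simp: a_def mk strict_mono_def convergent_const)
    qed
  qed
  then obtain s where s: "strict_mono (s :: nat \<Rightarrow> nat)" and conv: "\<And>i. convergent (\<lambda>n. a (s n) i)"
    by blast
  have conv_x: "Cauchy (\<lambda>n. u (s n) (x (s n) m k))" if "k \<in> {1..Suc m}" for m k
    using conv[of "prod_encode (m, k)"] that by (simp add: a_def convergent_Cauchy)
  have V_le: "\<bar>V n t - V n t'\<bar> \<le> V n (real k * h m) - V n ((real k - 1) * h m)"
    if "t \<in> J m k" "t' \<in> J m k" for n m k t t'
    using that monoD[OF V(1), of "(real k - 1) * h m" t n] monoD[OF V(1), of "(real k - 1) * h m" t' n]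
      monoD[OF V(1), of t "real k * h m" n] monoD[OF V(1), of t' "real k * h m" n]
    by (auto simp: J_def)
  define D where "D n m k = V n (real k * h m) - V n ((real k - 1) * h m)" for n m k
  have D: "D n m k \<ge> 0" for n m k
    unfolding D_def using h(1)[of m] by (simp add: algebra_simps monoD[OF V(1)])
  have C: "C \<ge> 0"
    using V(2,3) order_trans by blast
  have D_sum: "(\<Sum>k=1..Suc m. D n m k powr p) \<le> C powr p" for n m
  proof -
    have "(\<Sum>k=1..Suc m. D n m k) = (\<Sum>k<Suc m. V n (real (Suc k) * h m) - V n (real k * h m))"
      unfolding D_def by (rule sum.reindex_bij_witness[of _ Suc "\<lambda>k. k - 1"]) (auto simp: of_nat_diff)
    also have "\<dots> = V n (real (Suc m) * h m) - V n (real 0 * h m)"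
      by (rule sum_lessThan_telescope)
    also have "\<dots> \<le> C"
      using V(2)[of n "real 0 * h m"] V(3)[of n "real (Suc m) * h m"] by linarith
    finally have "(\<Sum>k=1..Suc m. D n m k) powr p \<le> C powr p"
      using D p by (intro powr_mono2 sum_nonneg) auto
    moreover have "(\<Sum>k=1..Suc m. D n m k powr p) \<le> (\<Sum>k=1..Suc m. D n m k) powr p"
      by (rule sum_powr_le_powr_sum) (use D p in auto)
    ultimately show ?thesis by linarith
  qed
  \<comment> \<open>On the k-th interval G dominates the p-th power of the oscillation of V there,
    and its integral is of order \<open>h m\<close>, uniformly in n.\<close>
  define G where "G n m t = (\<Sum>k=1..Suc m. ennreal (D n m k powr p) * indicator (J m k) t)" for n m t
  have J_sets: "J m k \<in> sets ?A" for m k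
    by (subst sets_restrict_space_iff) (auto simp: J_def)
  have [measurable]: "G n m \<in> borel_measurable ?A" for n m
    unfolding G_def using J_sets by (intro borel_measurable_sum borel_measurable_times_ennreal) auto
  have G_int: "(\<integral>\<^sup>+ t. G n m t \<partial>?A) \<le> ennreal (C powr p * h m)" for n m
  proof -
    have "(\<integral>\<^sup>+ t. G n m t \<partial>?A) \<le> ennreal ((\<Sum>k=1..Suc m. D n m k powr p) * h m)"
      unfolding G_def J_def by (rule nn_integral_partition_le) (use h in auto)
    also have "\<dots> \<le> ennreal (C powr p * h m)"
      using D_sum[of n m] h(1)[of m] by (intro ennreal_leI mult_right_mono) auto
    finally show ?thesis .
  qed
  have [measurable]: "(\<lambda>t. sn (u n t)) \<in> borel_measurable ?A" for n
    by (rule borel_measurable_simple_function) (rule simple_function_compose1[OF simple])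
  have "\<exists>N. \<forall>n\<ge>N. \<forall>n'\<ge>N. powr_nn_integral ?A p (\<lambda>t. u (s n) t - u (s n') t) \<le> ennreal e"
    if e: "e > 0" for e
  proof -
    define P where "P = 5 powr p"
    have P: "P > 0" by (simp add: P_def)
    \<comment> \<open>The order of choices matters: \<open>\<epsilon>\<close> is fitted to the bound
      K, then c comes from the Ehrling inequality, m makes the mesh small relative to c, and
      \<open>\<delta>\<close> measures the distance of the samples of this partition. The factors 2
      count the two members n and n'.\<close>
    obtain \<epsilon> where \<epsilon>: "\<epsilon> > 0" "P * 2 * K * \<epsilon> powr p \<le> e / 3"
      using ex_small_powr[of "P * 2 * K" "e / 3" p] P K e p by auto
    obtain c where c: "c \<ge> 0" and ehr_c: "\<And>n s t. s \<in> {0<..<T} \<Longrightarrow> t \<in> {0<..<T} \<Longrightarrow>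
        norm (u n t - u n s) \<le> \<epsilon> / 2 * (sn (u n t) + sn (u n s)) + c * \<bar>V n t - V n s\<bar>"
      using ehr[of "\<epsilon> / 2"] \<epsilon>(1) by auto
    obtain m where m: "P * 2 * c powr p * C powr p * h m \<le> e / 3"
    proof -
      obtain m where "P * 2 * c powr p * C powr p * T / (e / 3) < real m"
        using reals_Archimedean2 by blast
      then have "P * 2 * c powr p * C powr p * T \<le> e / 3 * real (Suc m)"
        using e by (simp add: field_simps)
      then have "P * 2 * c powr p * C powr p * h m \<le> e / 3"
        by (simp add: h_def field_simps)
      then show ?thesis by (rule that)
    qed
    obtain \<delta> where \<delta>: "\<delta> > 0" "P * T * \<delta> powr p \<le> e / 3"
      using ex_small_powr[of "P * T" "e / 3" p] P T e p by auto
    have "\<forall>k. \<exists>N. k \<in> {1..Suc m} \<longrightarrow> (\<forall>n\<ge>N. \<forall>n'\<ge>N.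
        norm (u (s n) (x (s n) m k) - u (s n') (x (s n') m k)) < \<delta>)"
      using conv_x \<delta>(1) unfolding Cauchy_iff by blast
    then obtain N where N: "\<And>k n n'. k \<in> {1..Suc m} \<Longrightarrow> n \<ge> N k \<Longrightarrow> n' \<ge> N k \<Longrightarrow>
        norm (u (s n) (x (s n) m k) - u (s n') (x (s n') m k)) < \<delta>"
      by metis
    have "powr_nn_integral ?A p (\<lambda>t. u (s n) t - u (s n') t) \<le> ennreal e"
      if n: "n \<ge> Max (N ` {1..Suc m})" "n' \<ge> Max (N ` {1..Suc m})" for n n'
    proof -
      have pt: "ennreal (norm (u (s n) t - u (s n') t) powr p) \<le>
          ennreal (P * \<epsilon> powr p) * (ennreal (sn (u (s n) t) powr p) + ennreal (sn (u (s n') t) powr p))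
          + ennreal (P * c powr p) * (G (s n) m t + G (s n') m t) + ennreal (P * \<delta> powr p)"
        if t: "t \<in> {0<..<T}" for t
      proof -
        define k where "k = step_index (h m) t"
        have k: "k \<in> {1..Suc m}" "t \<in> J m k"
          using cover[OF t] by (auto simp: k_def)
        have near: "norm (u j t - u j (x j m k)) \<le> \<epsilon> * sn (u j t) + c * D j m k" for j
        proof -
          have "norm (u j t - u j (x j m k)) \<le> \<epsilon> / 2 * (sn (u j t) + sn (u j (x j m k)))
              + c * \<bar>V j t - V j (x j m k)\<bar>"
            by (rule ehr_c[OF x_in[OF k(1)] t])
          \<comment> \<open>Minimality replaces [.] at the sample by [.] at t, whose p-th power has
            an integral bounded independently of the mesh.\<close>
          also have "\<dots> \<le> \<epsilon> / 2 * (sn (u j t) + sn (u j t)) + c * D j m k"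
            unfolding D_def using min[OF k, of j] V_le[OF k(2) x[OF k(1)], of j j] \<epsilon>(1) c
            by (intro add_mono mult_left_mono) auto
          finally show ?thesis by (simp add: algebra_simps)
        qed
        have D_le_G: "ennreal (D j m k powr p) \<le> G j m t" for j
        proof -
          have "ennreal (D j m k powr p) * indicator (J m k) t \<le> G j m t"
            unfolding G_def using k(1)
            by (intro member_le_sum[of k "{1..Suc m}" "\<lambda>k. ennreal (D j m k powr p) * indicator (J m k) t"]) auto
          then show ?thesis using k(2) by simp
        qed
        have "N k \<le> Max (N ` {1..Suc m})"
          using k by (intro Max_ge) auto
        then have "norm (u (s n) (x (s n) m k) - u (s n') (x (s n') m k)) < \<delta>"
          using n by (intro N[OF k(1)]) linarith+
        moreover have "norm (u (s n) t - u (s n') t) \<le> norm (u (s n) t - u (s n) (x (s n) m k))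
            + norm (u (s n) (x (s n) m k) - u (s n') (x (s n') m k))
            + norm (u (s n') t - u (s n') (x (s n') m k))"
          by norm
        ultimately have "norm (u (s n) t - u (s n') t) \<le>
            \<epsilon> * sn (u (s n) t) + \<epsilon> * sn (u (s n') t) + c * D (s n) m k + c * D (s n') m k + \<delta>"
          using near[of "s n"] near[of "s n'"] by linarith
        then have "norm (u (s n) t - u (s n') t) powr p \<le>
            (\<epsilon> * sn (u (s n) t) + \<epsilon> * sn (u (s n') t) + c * D (s n) m k + c * D (s n') m k + \<delta>) powr p"
          using p by (intro powr_mono2) auto
        also have "\<dots> \<le> P * ((\<epsilon> * sn (u (s n) t)) powr p + (\<epsilon> * sn (u (s n') t)) powr p
            + (c * D (s n) m k) powr p + (c * D (s n') m k) powr p + \<delta> powr p)"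
          unfolding P_def using \<epsilon>(1) c \<delta>(1) D sn[OF M[OF t]] p by (intro powr_add5_le) auto
        also have "\<dots> = P * \<epsilon> powr p * (sn (u (s n) t) powr p + sn (u (s n') t) powr p)
            + P * c powr p * (D (s n) m k powr p + D (s n') m k powr p) + P * \<delta> powr p"
          using \<epsilon>(1) c D sn[OF M[OF t]] by (simp add: powr_mult algebra_simps)
        finally have "ennreal (norm (u (s n) t - u (s n') t) powr p) \<le>
            ennreal (P * \<epsilon> powr p * (sn (u (s n) t) powr p + sn (u (s n') t) powr p)
            + P * c powr p * (D (s n) m k powr p + D (s n') m k powr p) + P * \<delta> powr p)"
          by (rule ennreal_leI)
        also have "\<dots> = ennreal (P * \<epsilon> powr p) * (ennreal (sn (u (s n) t) powr p) + ennreal (sn (u (s n') t) powr p))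
            + ennreal (P * c powr p) * (ennreal (D (s n) m k powr p) + ennreal (D (s n') m k powr p))
            + ennreal (P * \<delta> powr p)"
          using P by (simp add: ennreal_plus ennreal_mult)
        also have "\<dots> \<le> ennreal (P * \<epsilon> powr p) * (ennreal (sn (u (s n) t) powr p) + ennreal (sn (u (s n') t) powr p))
            + ennreal (P * c powr p) * (G (s n) m t + G (s n') m t) + ennreal (P * \<delta> powr p)"
          by (intro add_mono mult_left_mono D_le_G order_refl) auto
        finally show ?thesis .
      qed
      have "powr_nn_integral ?A p (\<lambda>t. u (s n) t - u (s n') t) \<le>
          (\<integral>\<^sup>+ t. ennreal (P * \<epsilon> powr p) * (ennreal (sn (u (s n) t) powr p) + ennreal (sn (u (s n') t) powr p))
            + ennreal (P * c powr p) * (G (s n) m t + G (s n') m t) + ennreal (P * \<delta> powr p) \<partial>?A)"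
        unfolding powr_nn_integral_def by (intro nn_integral_mono pt) simp
      also have "\<dots> = ennreal (P * \<epsilon> powr p) * ((\<integral>\<^sup>+ t. ennreal (sn (u (s n) t) powr p) \<partial>?A)
              + (\<integral>\<^sup>+ t. ennreal (sn (u (s n') t) powr p) \<partial>?A))
            + ennreal (P * c powr p) * ((\<integral>\<^sup>+ t. G (s n) m t \<partial>?A) + (\<integral>\<^sup>+ t. G (s n') m t \<partial>?A))
            + ennreal (P * \<delta> powr p) * ennreal T"
        using emeasure_lebesgue_on_Ioo[of 0 T T] T
        by (simp add: nn_integral_add nn_integral_cmult)
      also have "\<dots> \<le> ennreal (P * \<epsilon> powr p) * (ennreal K + ennreal K)
            + ennreal (P * c powr p) * (ennreal (C powr p * h m) + ennreal (C powr p * h m))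
            + ennreal (P * \<delta> powr p) * ennreal T"
        by (intro add_mono mult_left_mono bound G_int) auto
      also have "\<dots> = ennreal (P * \<epsilon> powr p * (K + K) + P * c powr p * (C powr p * h m + C powr p * h m)
            + P * \<delta> powr p * T)"
      proof -
        have "ennreal a * (ennreal b + ennreal b) + ennreal c * (ennreal d + ennreal d) + ennreal f * ennreal g
            = ennreal (a * (b + b) + c * (d + d) + f * g)"
          if "a \<ge> 0" "b \<ge> 0" "c \<ge> 0" "d \<ge> 0" "f \<ge> 0" "g \<ge> 0" for a b c d f g
          using that by (simp flip: ennreal_plus ennreal_mult)
        then show ?thesis
          using P K h(1)[of m] T by simp
      qed
      also have "\<dots> \<le> ennreal (e / 3 + e / 3 + e / 3)"
        using \<epsilon>(2) m \<delta>(2) by (intro ennreal_leI add_mono) (auto simp: algebra_simps)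
      finally show ?thesis by simp
    qed
    then show ?thesis by blast
  qed
  then obtain r g where r: "strict_mono (r :: nat \<Rightarrow> nat)" "strongly_measurable ?A g"
    "(\<lambda>n. powr_nn_integral ?A p (\<lambda>t. u (s (r n)) t - g t)) \<longlonglongrightarrow> 0"
    using powr_nn_integral_Cauchy_subseq[of p ?A "\<lambda>n. u (s n)"] p simple by auto
  then show ?thesis
    using strict_mono_o[OF s r(1)] by (intro exI[of _ "s \<circ> r"] exI[of _ g]) simp
qed

section \<open>The case of an infinite exponent\<close>

context step_function
begin

text \<open>Subtracting s <= k_s \<tau> from (k_t - 1) \<tau> < t leaves one extra
  \<open>\<tau>\<close>: arbitrarily close times may be separated by a jump. This is the error up to
  which equicontinuity holds.\<close>

lemma card_step_indices_le:
  assumes "s \<in> {0<..<T}" "t \<in> {0<..<T}" "s \<le> t"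
  shows "real (card {step_index \<tau> s..<step_index \<tau> t}) * \<tau> \<le> t - s + \<tau>"
proof -
  have "real (card {step_index \<tau> s..<step_index \<tau> t}) = real (step_index \<tau> t) - real (step_index \<tau> s)"
    using step_index_mono[OF \<tau>_pos assms(3)] by (simp add: of_nat_diff)
  then show ?thesis
    using step_index_bounds(2)[OF \<tau>_pos, of t] step_index_bounds(3)[OF \<tau>_pos, of s] assms
    by (simp add: left_diff_distrib)
qed

lemma step_variation_modulus:
  assumes st: "s \<in> {0<..<T}" "t \<in> {0<..<T}" "s \<le> t"
    and r: "r > 1" and C: "C > 0" and l: "l > 0"
    and le: "(\<Sum>k=1..<N. norm (b (Suc k) - b k) powr r * \<tau>) \<le> (C * \<tau>) powr r"
  shows "step_variation \<tau> N b t - step_variation \<tau> N b s \<le> l * (t - s + \<tau>) + l powr (1 - r) * C powr r"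
proof -
  define S where "S = {step_index \<tau> s..<step_index \<tau> t}"
  have S: "S \<subseteq> {1..<N}"
    using step_index_ge_1[OF st(1)] step_index_le_N[OF st(2)] by (auto simp: S_def)
  have "(\<Sum>k\<in>S. norm (b (Suc k) - b k) powr r * \<tau>) \<le> (\<Sum>k=1..<N. norm (b (Suc k) - b k) powr r * \<tau>)"
    using S \<tau>_pos by (intro sum_mono2) auto
  then have "(\<Sum>k\<in>S. norm (b (Suc k) - b k)) \<le> l * (real (card S) * \<tau>) + l powr (1 - r) * C powr r"
    using le r l C \<tau>_pos by (intro sum_le_of_powr_sum) (auto simp: S_def)
  also have "\<dots> \<le> l * (t - s + \<tau>) + l powr (1 - r) * C powr r"
    using card_step_indices_le[OF st] l by (simp add: S_def)
  finally show ?thesis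
    using step_variation_diff[OF step_index_ge_1[OF st(1)] step_index_mono[OF \<tau>_pos st(3)] step_index_le_N[OF st(2)], of b]
    by (simp add: S_def)
qed

lemma step_variation_lipschitz:
  assumes st: "s \<in> {0<..<T}" "t \<in> {0<..<T}" "s \<le> t"
    and C: "C > 0"
    and le: "\<And>k. 1 \<le> k \<Longrightarrow> k \<le> N - 1 \<Longrightarrow> norm (b (Suc k) - b k) \<le> C * \<tau>"
  shows "step_variation \<tau> N b t - step_variation \<tau> N b s \<le> C * (t - s + \<tau>)"
proof -
  define S where "S = {step_index \<tau> s..<step_index \<tau> t}"
  have "(\<Sum>k\<in>S. norm (b (Suc k) - b k)) \<le> (\<Sum>k\<in>S. C * \<tau>)"
    using step_index_ge_1[OF st(1)] step_index_le_N[OF st(2)] by (intro sum_mono le) (auto simp: S_def)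
  also have "\<dots> = C * (real (card S) * \<tau>)"
    by simp
  also have "\<dots> \<le> C * (t - s + \<tau>)"
    using card_step_indices_le[OF st] C by (simp add: S_def)
  finally show ?thesis
    using step_variation_diff[OF step_index_ge_1[OF st(1)] step_index_mono[OF \<tau>_pos st(3)] step_index_le_N[OF st(2)], of b]
    by (simp add: S_def)
qed

end

text \<open>An Arzela-Ascoli argument for discontinuous functions: a modulus that holds only for
  large n is enough, since the limit inherits it exactly.\<close>

lemma equicontinuous_subseq_tendsto:
  fixes u :: "nat \<Rightarrow> real \<Rightarrow> 'b::banach"
  assumes T: "T > 0"
    and cpt: "\<And>t s. t \<in> {0<..<T} \<Longrightarrow> strict_mono (s :: nat \<Rightarrow> nat) \<Longrightarrow>
      \<exists>r. strict_mono (r :: nat \<Rightarrow> nat) \<and> convergent (\<lambda>n. u (s (r n)) t)"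
    and equi: "\<And>e. e > 0 \<Longrightarrow> \<exists>\<delta>>0. \<exists>n0. \<forall>n\<ge>n0. \<forall>s\<in>{0<..<T}. \<forall>t\<in>{0<..<T}.
      s \<le> t \<longrightarrow> t - s < \<delta> \<longrightarrow> norm (u n t - u n s) \<le> e"
  shows "\<exists>s f. strict_mono (s :: nat \<Rightarrow> nat) \<and> continuous_on {0..T} f \<and>
    (\<forall>t\<in>{0<..<T}. (\<lambda>n. u (s n) t) \<longlonglongrightarrow> f t)"
proof -
  define X where "X = \<rat> \<inter> {0<..<T}"
  \<comment> \<open>The rational point is taken to the right of t, in line with the ordered pairs in
    \<open>equi\<close>, and is capped by T to stay in the domain.\<close>
  have X_dense: "\<exists>x\<in>X. t < x \<and> x < t + \<delta>" if "t \<in> {0<..<T}" "\<delta> > 0" for t \<delta>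
    using Rats_dense_in_real[of t "min T (t + \<delta>)"] that by (force simp: X_def)
  have X: "countable X" "X \<noteq> {}"
    using countable_rat X_dense[of "T/2" 1] T by (auto simp: X_def)
  define \<rho> where "\<rho> = from_nat_into X"
  have \<rho>: "range \<rho> = X"
    unfolding \<rho>_def by (rule range_from_nat_into[OF X(2,1)])
  have "\<exists>s. strict_mono (s :: nat \<Rightarrow> nat) \<and> (\<forall>i. convergent (\<lambda>n. u (s n) (\<rho> i)))"
    using \<rho> by (intro diagonal_convergent_subseq cpt) (auto simp: X_def)
  then obtain s where s: "strict_mono (s :: nat \<Rightarrow> nat)" and conv_X: "\<And>i. convergent (\<lambda>n. u (s n) (\<rho> i))"
    by blast
  have Cauchy: "Cauchy (\<lambda>n. u (s n) t)" if t: "t \<in> {0<..<T}" for t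
    unfolding Cauchy_iff
  proof (intro allI impI)
    fix e :: real assume e: "e > 0"
    then have "e / 4 > 0" by simp
    then obtain \<delta> n0 where \<delta>: "\<delta> > 0" and n0: "\<And>n a b. n \<ge> n0 \<Longrightarrow> a \<in> {0<..<T} \<Longrightarrow> b \<in> {0<..<T} \<Longrightarrow>
        a \<le> b \<Longrightarrow> b - a < \<delta> \<Longrightarrow> norm (u n b - u n a) \<le> e / 4"
      using equi by meson
    obtain x where x: "x \<in> X" "t < x" "x < t + \<delta>"
      using X_dense[OF t \<delta>] by blast
    obtain i where i: "x = \<rho> i"
      using x(1) \<rho> by blast
    obtain K where K: "\<And>m n. m \<ge> K \<Longrightarrow> n \<ge> K \<Longrightarrow> norm (u (s m) x - u (s n) x) < e / 4"
      using convergent_Cauchy[OF conv_X[of i]] e unfolding Cauchy_iff i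
      by (metis zero_less_divide_iff zero_less_numeral)
    have near: "norm (u (s n) x - u (s n) t) \<le> e / 4" if "n \<ge> n0" for n
      using that seq_suble[OF s, of n] x t by (intro n0) (auto simp: X_def)
    have "norm (u (s m) t - u (s n) t) < e" if "m \<ge> max K n0" "n \<ge> max K n0" for m n
    proof -
      have "norm (u (s m) t - u (s n) t) \<le> norm (u (s m) x - u (s m) t)
          + norm (u (s m) x - u (s n) x) + norm (u (s n) x - u (s n) t)"
        by norm
      then show ?thesis
        using near[of m] near[of n] K[of m n] that e by auto
    qed
    then show "\<exists>M. \<forall>m\<ge>M. \<forall>n\<ge>M. norm (u (s m) t - u (s n) t) < e"
      by blast
  qed
  define g where "g t = lim (\<lambda>n. u (s n) t)" for t
  have g: "(\<lambda>n. u (s n) t) \<longlonglongrightarrow> g t" if "t \<in> {0<..<T}" for t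
    using Cauchy_convergent[OF Cauchy[OF that]] by (simp add: g_def convergent_LIMSEQ_iff)
  \<comment> \<open>Uniform continuity, and not mere continuity, is what extends the limit to the
    end points 0 and T.\<close>
  have "uniformly_continuous_on {0<..<T} g"
    unfolding uniformly_continuous_on_def
  proof (intro allI impI)
    fix e :: real assume e: "e > 0"
    then have "e / 2 > 0" by simp
    then obtain \<delta> n0 where \<delta>: "\<delta> > 0" and n0: "\<And>n a b. n \<ge> n0 \<Longrightarrow> a \<in> {0<..<T} \<Longrightarrow> b \<in> {0<..<T} \<Longrightarrow>
        a \<le> b \<Longrightarrow> b - a < \<delta> \<Longrightarrow> norm (u n b - u n a) \<le> e / 2"
      using equi by meson
    have le: "norm (g b - g a) \<le> e / 2"
      if ab: "a \<in> {0<..<T}" "b \<in> {0<..<T}" "a \<le> b" "b - a < \<delta>" for a b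
    proof (rule LIMSEQ_le_const2)
      show "(\<lambda>n. norm (u (s n) b - u (s n) a)) \<longlonglongrightarrow> norm (g b - g a)"
        by (intro tendsto_norm tendsto_diff g ab)
      have "norm (u (s n) b - u (s n) a) \<le> e / 2" if "n \<ge> n0" for n
        using that seq_suble[OF s, of n] ab by (intro n0) auto
      then show "\<exists>N. \<forall>n\<ge>N. norm (u (s n) b - u (s n) a) \<le> e / 2"
        by blast
    qed
    have "dist (g b) (g a) < e" if "a \<in> {0<..<T}" "b \<in> {0<..<T}" "dist b a < \<delta>" for a b
      using le[of a b] le[of b a] that e by (cases "a \<le> b") (auto simp: dist_norm norm_minus_commute)
    then show "\<exists>d>0. \<forall>x\<in>{0<..<T}. \<forall>x'\<in>{0<..<T}. dist x' x < d \<longrightarrow> dist (g x') (g x) < e"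
      using \<delta> by blast
  qed
  then obtain f where f: "uniformly_continuous_on (closure {0<..<T}) f" "\<And>t. t \<in> {0<..<T} \<Longrightarrow> g t = f t"
    using uniformly_continuous_on_extension_on_closure by metis
  have "continuous_on {0..T} f"
    using uniformly_continuous_imp_continuous[OF f(1)] T by simp
  then show ?thesis
    using s g f(2) by (intro exI[of _ s] exI[of _ f]) auto
qed

text \<open>The bound B passes to the limit, so the constant (2B)^p dominates on a bounded interval.
  The simple functions \<open>v n\<close> themselves witness the strong measurability of f.\<close>

lemma Lp_converges_bounded_pointwise:
  fixes v :: "nat \<Rightarrow> real \<Rightarrow> 'b::real_normed_vector"
  assumes T: "T > 0" and p: "1 \<le> p" "p < \<infinity>"
    and simple: "\<And>n. simple_function (lebesgue_on {0<..<T}) (v n)"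
    and bound: "\<And>n t. t \<in> {0<..<T} \<Longrightarrow> norm (v n t) \<le> B"
    and lim: "\<And>t. t \<in> {0<..<T} \<Longrightarrow> (\<lambda>n. v n t) \<longlonglongrightarrow> f t"
  shows "Lp_converges p T v f"
proof -
  let ?A = "lebesgue_on {0<..<T}" and ?P = "enn2real p"
  have P: "?P \<ge> 1"
    by (rule enn2real_ge_1[OF p])
  have v_meas: "strongly_measurable ?A (v n)" for n
    by (rule strongly_measurable_LIMSEQ_simple[of _ "\<lambda>_. v n"]) (auto simp: simple)
  have f_meas: "strongly_measurable ?A f"
    by (rule strongly_measurable_LIMSEQ_simple[of _ v]) (rule simple, rule AE_I2, simp add: lim)
  have f_bound: "norm (f t) \<le> B" if "t \<in> {0<..<T}" for t
    using LIMSEQ_le_const2[OF tendsto_norm[OF lim[OF that]]] bound[OF that] by blast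
  have v: "v n \<in> Lp_fun p T" for n
    by (rule Lp_fun_bounded[OF p T v_meas bound])
  have f: "f \<in> Lp_fun p T"
    by (rule Lp_fun_bounded[OF p T f_meas f_bound])
  have [measurable]: "(\<lambda>t. norm (v n t - f t)) \<in> borel_measurable ?A" for n
    by (intro norm_Lp_fun_measurable strongly_measurable_diff v_meas f_meas)
  have "(\<lambda>n. \<integral>\<^sup>+ t. ennreal (norm (v n t - f t) powr ?P) \<partial>?A) \<longlonglongrightarrow> (\<integral>\<^sup>+ t. 0 \<partial>?A)"
  proof (rule nn_integral_dominated_convergence[where w="\<lambda>_. ennreal ((2 * B) powr ?P)"])
    show "AE t in ?A. ennreal (norm (v n t - f t) powr ?P) \<le> ennreal ((2 * B) powr ?P)" for n
    proof (rule AE_I2)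
      fix t assume "t \<in> space ?A"
      then have "norm (v n t - f t) \<le> 2 * B"
        using norm_triangle_ineq4[of "v n t" "f t"] bound[of t n] f_bound[of t] by simp
      then show "ennreal (norm (v n t - f t) powr ?P) \<le> ennreal ((2 * B) powr ?P)"
        using P by (intro ennreal_leI powr_mono2) auto
    qed
    show "AE t in ?A. (\<lambda>n. ennreal (norm (v n t - f t) powr ?P)) \<longlonglongrightarrow> 0"
    proof (rule AE_I2)
      fix t assume "t \<in> space ?A"
      then have "(\<lambda>n. norm (v n t - f t)) \<longlonglongrightarrow> 0"
        using lim[of t] by (simp add: LIM_zero tendsto_norm_zero)
      then have "(\<lambda>n. norm (v n t - f t) powr ?P) \<longlonglongrightarrow> 0"
        using P by (intro tendsto_zero_powrI[OF _ tendsto_const]) auto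
      then show "(\<lambda>n. ennreal (norm (v n t - f t) powr ?P)) \<longlonglongrightarrow> 0"
        using tendsto_ennrealI by fastforce
    qed
    show "(\<integral>\<^sup>+ t. ennreal ((2 * B) powr ?P) \<partial>?A) < \<infinity>"
      using emeasure_lebesgue_on_Ioo[of 0 T T] T by (simp flip: ennreal_mult')
  qed auto
  then show ?thesis
    using v f by (intro Lp_convergesI[OF p]) (auto simp: powr_nn_integral_def)
qed

section \<open>Compactness of piecewise constant functions\<close>

theorem theorem2:
  fixes \<iota> :: "'b::banach \<Rightarrow> 'v::real_vector"
    and \<kappa> :: "'y::banach \<Rightarrow> 'v"
    and M :: "'b set"
    and sn :: "'b \<Rightarrow> real"
    and T :: real
    and p r :: ennreal
    and N :: "nat \<Rightarrow> nat"
    and \<tau> :: "nat \<Rightarrow> real"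
    and u :: "nat \<Rightarrow> real \<Rightarrow> 'b"
  assumes T: "T > 0"
    and embeddings: "linear \<iota>" "inj \<iota>" "linear \<kappa>" "inj \<kappa>"
    and cone: "seminormed_cone M sn"
    and exponents: "(1 \<le> p \<and> p < \<infinity> \<and> r = 1) \<or> (p = \<infinity> \<and> r > 1)"
    and steps: "\<And>n. N n \<ge> 1" "\<And>n. \<tau> n = T / real (N n)"
    and steps_to_0: "p = \<infinity> \<Longrightarrow> \<tau> \<longlonglongrightarrow> 0"
    and u_cone: "\<And>n. u n \<in> Lp_cone p T M sn"
    and u_Y: "\<And>n. u n \<in> Lp_other \<iota> \<kappa> p T"
    and piecewise_constant:
      "\<And>n k. 1 \<le> k \<Longrightarrow> k \<le> N n \<Longrightarrow>
         u n constant_on ({(real k - 1) * \<tau> n <.. real k * \<tau> n} \<inter> {0<..<T})"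
    and i: "compactly_embedded M sn"
    and ii: "\<And>(w :: nat \<Rightarrow> 'b) w0.
         w \<longlonglongrightarrow> w0 \<Longrightarrow> (\<And>n. in_both \<iota> \<kappa> (w n)) \<Longrightarrow>
         (\<lambda>n. as_other \<iota> \<kappa> (w n)) \<longlonglongrightarrow> 0 \<Longrightarrow> w0 = 0"
    and iii: "\<exists>K::real. \<forall>n. Lp_norm p T (\<lambda>t. sn (u n t)) \<le> ennreal K"
    and iv: "\<exists>C::real. C > 0 \<and>
         (\<forall>n. Lp_norm r (T - \<tau> n)
                (\<lambda>t. norm (as_other \<iota> \<kappa> (u n (t + \<tau> n) - u n t))) \<le> ennreal (C * \<tau> n))"
  shows "(p < \<infinity> \<longrightarrow> Lp_relatively_compact p T (range u)) \<and>
         (p = \<infinity> \<longrightarrow>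
            (\<exists>s f. strict_mono s \<and> continuous_on {0..T} f \<and>
               (\<forall>q. 1 \<le> q \<and> q < \<infinity> \<longrightarrow> Lp_converges q T (\<lambda>n. u (s n)) f)))"
proof -
  let ?A = "lebesgue_on {0<..<T}"
  have step: "step_function T (\<tau> n) (N n) (u n)" for n
    by standard (use T steps piecewise_constant in auto)
  note \<tau>_pos = step_function.\<tau>_pos[OF step]
  define y where "y x = as_other \<iota> \<kappa> x" for x
  define b where "b n k = y (step_function.val (\<tau> n) (u n) k)" for n k
  define V where "V n = step_variation (\<tau> n) (N n) (b n)" for n
  have emb: "linear \<iota>" "linear \<kappa>" "inj \<kappa>"
    using embeddings by auto
  have M: "u n t \<in> M" if "t \<in> {0<..<T}" for n t
  proof (rule step_function.all_of_AE[OF step _ that, where Q="\<lambda>x. x \<in> M"])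
    show "AE t in ?A. u n t \<in> M"
      using u_cone[of n] by (simp add: Lp_cone_def)
  qed
  have both: "in_both \<iota> \<kappa> (u n t)" if "t \<in> {0<..<T}" for n t
  proof (rule step_function.all_of_AE[OF step _ that, where Q="in_both \<iota> \<kappa>"])
    show "AE t in ?A. in_both \<iota> \<kappa> (u n t)"
      using u_Y[of n] by (simp add: Lp_other_def)
  qed
  have simple: "simple_function ?A (u n)" for n
    by (rule step_function.simple[OF step])
  have sn: "sn x \<ge> 0" if "x \<in> M" for x
    using cone that by (auto simp: seminormed_cone_def)
  \<comment> \<open>\<open>as_other\<close> is additive only on the intersection of the spaces, so
    both values must be known to lie in Y.\<close>
  have jump: "y (step_function.val (\<tau> n) (u n) (Suc k) - step_function.val (\<tau> n) (u n) k) = b n (Suc k) - b n k"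
    if "1 \<le> k" "k < N n" for n k
  proof -
    have "in_both \<iota> \<kappa> (step_function.val (\<tau> n) (u n) j)" if "1 \<le> j" "j \<le> N n" for j
      by (rule step_function.all_val[OF step _ that, where P="in_both \<iota> \<kappa>"]) (rule both)
    then show ?thesis
      using that unfolding b_def y_def by (intro in_both_diff(2)[OF emb]) auto
  qed
  have y_u: "y (u n t) = b n (step_index (\<tau> n) t)" if "t \<in> {0<..<T}" for n t
    using step_function.val_step_index[OF step that] by (simp add: b_def)
  have V_jump: "norm (y (u n t) - y (u n s)) \<le> V n t - V n s"
    if st: "s \<in> {0<..<T}" "t \<in> {0<..<T}" "s \<le> t" for n s t
    unfolding V_def y_u[OF st(1)] y_u[OF st(2)]
    by (intro norm_diff_le_step_variation step_function.step_index_ge_1[OF step st(1)]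
        step_function.step_index_le_N[OF step st(2)] step_index_mono[OF \<tau>_pos st(3)])
  have V_mono: "mono (V n)" for n
    unfolding V_def by (rule mono_step_variation[OF \<tau>_pos])
  have ehr: "\<exists>c\<ge>0. \<forall>n. \<forall>s\<in>{0<..<T}. \<forall>t\<in>{0<..<T}.
      norm (u n t - u n s) \<le> \<epsilon> * (sn (u n t) + sn (u n s)) + c * \<bar>V n t - V n s\<bar>" if \<epsilon>: "\<epsilon> > 0" for \<epsilon>
  proof -
    have "\<exists>c\<ge>0. \<forall>x\<in>M. \<forall>z\<in>M. in_both \<iota> \<kappa> x \<longrightarrow> in_both \<iota> \<kappa> z \<longrightarrow>
        norm (x - z) \<le> \<epsilon> * (sn x + sn z) + c * norm (y x - y z)"
      unfolding y_def by (rule ehrling_cone[OF emb cone i _ \<epsilon>]) (rule ii)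
    then obtain c where c: "c \<ge> 0" and le: "\<And>x z. x \<in> M \<Longrightarrow> z \<in> M \<Longrightarrow> in_both \<iota> \<kappa> x \<Longrightarrow> in_both \<iota> \<kappa> z \<Longrightarrow>
        norm (x - z) \<le> \<epsilon> * (sn x + sn z) + c * norm (y x - y z)"
      by blast
    have "norm (u n t - u n s) \<le> \<epsilon> * (sn (u n t) + sn (u n s)) + c * \<bar>V n t - V n s\<bar>"
      if st: "s \<in> {0<..<T}" "t \<in> {0<..<T}" for n s t
    proof -
      have "norm (y (u n t) - y (u n s)) \<le> \<bar>V n t - V n s\<bar>"
        using V_jump[OF st, of n] V_jump[OF st(2,1), of n]
        by (cases "s \<le> t") (auto simp: norm_minus_commute)
      then have "c * norm (y (u n t) - y (u n s)) \<le> c * \<bar>V n t - V n s\<bar>"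
        using c by (rule mult_left_mono)
      then show ?thesis
        using le[OF M[OF st(2), of n] M[OF st(1), of n] both[OF st(2)] both[OF st(1)]] by linarith
    qed
    then show ?thesis using c by blast
  qed
  obtain K0 where "\<And>n. Lp_norm p T (\<lambda>t. sn (u n t)) \<le> ennreal K0"
    using iii by blast
  \<comment> \<open>A negative bound becomes 0 under \<open>ennreal\<close>, so K may be taken
    nonnegative.\<close>
  then obtain K where K: "K \<ge> 0" "\<And>n. Lp_norm p T (\<lambda>t. sn (u n t)) \<le> ennreal K"
    by (metis ennreal_neg linorder_linear order_refl ennreal_0)
  obtain C where C: "C > 0" and iv': "\<And>n. Lp_norm r (T - \<tau> n) (\<lambda>t. norm (y (u n (t + \<tau> n) - u n t))) \<le> ennreal (C * \<tau> n)"
    using iv unfolding y_def by blast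
  have C_\<tau>: "C * \<tau> n \<ge> 0" for n
    using C \<tau>_pos[of n] by simp
  have powr_sum: "(\<Sum>k=1..<N n. norm (b n (Suc k) - b n k) powr enn2real r * \<tau> n) \<le> (C * \<tau> n) powr enn2real r"
    if r: "1 \<le> r" "r < \<infinity>" for n
    using step_function.jump_powr_sum_le[OF step r C_\<tau> iv', of n] by (simp add: jump)
  have finite_case: "Lp_relatively_compact p T (range u)" if p_fin: "p < \<infinity>"
  proof -
    have p: "1 \<le> p" "p < \<infinity>" and r1: "r = 1"
      using exponents p_fin by auto
    have P: "enn2real p \<ge> 1"
      by (rule enn2real_ge_1[OF p])
    \<comment> \<open>For r = 1 the factor \<open>\<tau> n\<close> occurs on both sides and cancels,
      which bounds the variation uniformly in n.\<close>
    have V_le: "V n t \<le> C" for n t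
    proof -
      have "(\<Sum>k=1..<N n. norm (b n (Suc k) - b n k)) * \<tau> n \<le> C * \<tau> n"
        using powr_sum[of n] r1 C_\<tau>[of n] by (simp add: sum_distrib_right)
      then have "(\<Sum>k=1..<N n. norm (b n (Suc k) - b n k)) \<le> C"
        using \<tau>_pos[of n] by simp
      then show ?thesis
        unfolding V_def using step_variation_bounds(2) order_trans by blast
    qed
    have int_le: "(\<integral>\<^sup>+ t. ennreal (sn (u n t) powr enn2real p) \<partial>?A) \<le> ennreal (K powr enn2real p)" for n
    proof -
      have "(\<integral>\<^sup>+ t. ennreal (sn (u n t) powr enn2real p) \<partial>?A)
          = (\<integral>\<^sup>+ t. ennreal (\<bar>sn (u n t)\<bar> powr enn2real p) \<partial>?A)"
        using sn[OF M] by (intro nn_integral_cong) simp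
      then show ?thesis
        using Lp_norm_le_imp_nn_integral_le[OF p K(2)[of n] K(1)] by simp
    qed
    have u_Lp: "u n \<in> Lp_fun p T" for n
    proof -
      have "finite (norm ` u n ` {0<..<T})"
        using simple_functionD(1)[OF simple[of n]] by simp
      then have "norm (u n t) \<le> Max (norm ` u n ` {0<..<T})" if "t \<in> {0<..<T}" for t
        using that by (intro Max_ge) auto
      moreover have "strongly_measurable ?A (u n)"
        by (rule strongly_measurable_LIMSEQ_simple[of _ "\<lambda>_. u n"]) (auto simp: simple)
      ultimately show ?thesis
        using Lp_fun_bounded[OF p T] by blast
    qed
    show ?thesis
    proof (rule Lp_relatively_compactI[OF p u_Lp])
      fix \<sigma> :: "nat \<Rightarrow> nat"
      have "\<exists>s g. strict_mono (s :: nat \<Rightarrow> nat) \<and> strongly_measurable ?A g \<and>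
          (\<lambda>n. powr_nn_integral ?A (enn2real p) (\<lambda>t. u (\<sigma> (s n)) t - g t)) \<longlonglongrightarrow> 0"
      \<comment> \<open>All constants are uniform in n, so they survive the reindexing by
        \<open>\<sigma>\<close>.\<close>
      proof (rule Lp_precompact[where u="\<lambda>n. u (\<sigma> n)" and V="\<lambda>n. V (\<sigma> n)" and M=M and sn=sn and C=C])
        show "0 \<le> K powr enn2real p" by simp
        show "\<exists>c\<ge>0. \<forall>n. \<forall>s\<in>{0<..<T}. \<forall>t\<in>{0<..<T}. norm (u (\<sigma> n) t - u (\<sigma> n) s)
            \<le> \<epsilon> * (sn (u (\<sigma> n) t) + sn (u (\<sigma> n) s)) + c * \<bar>V (\<sigma> n) t - V (\<sigma> n) s\<bar>"
          if "\<epsilon> > 0" for \<epsilon>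
          using ehr[OF that] by blast
        show "0 \<le> V (\<sigma> n) t" for n t
          unfolding V_def by (rule step_variation_bounds(1))
      qed (use T P simple M sn i V_mono V_le int_le in auto)
      then obtain s g where s: "strict_mono (s :: nat \<Rightarrow> nat)" and g: "strongly_measurable ?A g"
        and lim: "(\<lambda>n. powr_nn_integral ?A (enn2real p) (\<lambda>t. u (\<sigma> (s n)) t - g t)) \<longlonglongrightarrow> 0"
        by blast
      \<comment> \<open>The limit g lies in the space because it is u minus (u - g) for one member u
        at finite distance.\<close>
      have "\<forall>\<^sub>F n in sequentially. powr_nn_integral ?A (enn2real p) (\<lambda>t. u (\<sigma> (s n)) t - g t) < 1"
        using lim by (rule order_tendstoD) simp
      then obtain n where n: "powr_nn_integral ?A (enn2real p) (\<lambda>t. u (\<sigma> (s n)) t - g t) < 1"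
        using eventually_happens'[OF sequentially_bot] by blast
      have "strongly_measurable ?A (\<lambda>t. u (\<sigma> (s n)) t - g t)"
        using u_Lp g by (intro strongly_measurable_diff) (auto simp: Lp_fun_def)
      then have "(\<lambda>t. u (\<sigma> (s n)) t - g t) \<in> Lp_fun p T"
        using n less_trans[OF n ennreal_one_less_top] by (simp add: Lp_fun_iff[OF p(2)])
      then have "(\<lambda>t. u (\<sigma> (s n)) t - (u (\<sigma> (s n)) t - g t)) \<in> Lp_fun p T"
        by (rule Lp_fun_diff[OF p u_Lp])
      then have "g \<in> Lp_fun p T"
        by simp
      then show "\<exists>s g. strict_mono s \<and> g \<in> Lp_fun p T \<and>
          (\<lambda>n. powr_nn_integral ?A (enn2real p) (\<lambda>t. u (\<sigma> (s n)) t - g t)) \<longlonglongrightarrow> 0"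
        using s lim by blast
    qed
  qed
  have infinite_case: "\<exists>s f. strict_mono s \<and> continuous_on {0..T} f \<and>
      (\<forall>q. 1 \<le> q \<and> q < \<infinity> \<longrightarrow> Lp_converges q T (\<lambda>n. u (s n)) f)" if p_inf: "p = \<infinity>"
  proof -
    have r: "r > 1" and \<tau>_0: "\<tau> \<longlonglongrightarrow> 0"
      using exponents p_inf steps_to_0 by auto
    have sn_le: "sn (u n t) \<le> K" if "t \<in> {0<..<T}" for n t
    proof (rule step_function.all_of_AE[OF step _ that, where Q="\<lambda>x. sn x \<le> K"])
      have "AE t in ?A. ennreal \<bar>sn (u n t)\<bar> \<le> esssup ?A (\<lambda>t. ennreal \<bar>sn (u n t)\<bar>)"
        by (rule esssup_AE)
      then show "AE t in ?A. sn (u n t) \<le> K"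
        by eventually_elim (use K(2)[of n] K(1) p_inf in \<open>auto simp: Lp_norm_def dest: order_trans\<close>)
    qed
    \<comment> \<open>The slope l depends on \<open>\<eta>\<close> but not on n. For r infinite the
      slope C serves every \<open>\<eta>\<close>; for finite r it may grow as \<open>\<eta>\<close>
      shrinks.\<close>
    have modulus: "\<exists>l>0. \<forall>n. \<forall>s\<in>{0<..<T}. \<forall>t\<in>{0<..<T}. s \<le> t \<longrightarrow> V n t - V n s \<le> l * (t - s + \<tau> n) + \<eta>"
      if \<eta>: "\<eta> > 0" for \<eta>
    proof (cases "r = \<infinity>")
      case True
      have "norm (b n (Suc k) - b n k) \<le> C * \<tau> n" if "1 \<le> k" "k \<le> N n - 1" for n k
        using step_function.jump_le_esssup[OF step C_\<tau> that iv'[of n, unfolded True]] jump[of k n] that by simp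
      then have "V n t - V n s \<le> C * (t - s + \<tau> n)"
        if "s \<in> {0<..<T}" "t \<in> {0<..<T}" "s \<le> t" for n s t
        unfolding V_def using that C by (intro step_function.step_variation_lipschitz[OF step]) auto
      then show ?thesis
        using C \<eta> by (intro exI[of _ C]) (fastforce simp: add_increasing2)
    next
      case False
      then have r_fin: "r < \<infinity>" by (simp add: less_top)
      define r' where "r' = enn2real r"
      have r': "r' > 1"
        using r r_fin unfolding r'_def by (cases r) (auto simp: ennreal_less_iff simp flip: ennreal_1)
      \<comment> \<open>Here x = 1 / l, so that l^(1-r') C^r' = C^r' x^(r'-1), which is small for
        small x because r' > 1.\<close>
      obtain x where x: "x > 0" "C powr r' * x powr (r' - 1) \<le> \<eta>"
        using ex_small_powr[of "C powr r'" \<eta> "r' - 1"] \<eta> r' by auto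
      have small: "(1 / x) powr (1 - r') * C powr r' \<le> \<eta>"
        using x by (simp add: powr_divide powr_minus_divide[symmetric] mult.commute)
      have "V n t - V n s \<le> 1 / x * (t - s + \<tau> n) + (1 / x) powr (1 - r') * C powr r'"
        if "s \<in> {0<..<T}" "t \<in> {0<..<T}" "s \<le> t" for n s t
        unfolding V_def using that x C r' powr_sum[of n] r r_fin
        by (intro step_function.step_variation_modulus[OF step]) (auto simp: r'_def)
      then have "V n t - V n s \<le> 1 / x * (t - s + \<tau> n) + \<eta>"
        if "s \<in> {0<..<T}" "t \<in> {0<..<T}" "s \<le> t" for n s t
        using that small by (meson add_left_mono order_trans)
      moreover have "1 / x > 0"
        using x(1) by simp
      ultimately show ?thesis
        by blast
    qed
    have equi: "\<exists>\<delta>>0. \<exists>n0. \<forall>n\<ge>n0. \<forall>s\<in>{0<..<T}. \<forall>t\<in>{0<..<T}.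
        s \<le> t \<longrightarrow> t - s < \<delta> \<longrightarrow> norm (u n t - u n s) \<le> e" if e: "e > 0" for e
    proof -
      \<comment> \<open>Half of e is for the [.] terms, at most K each, and half for the variation;
        the 1 added to K, and below to c, avoids division by 0.\<close>
      define \<epsilon> where "\<epsilon> = e / (4 * (K + 1))"
      have \<epsilon>: "\<epsilon> > 0" "2 * \<epsilon> * K \<le> e / 2"
        using e K(1) by (auto simp: \<epsilon>_def field_simps)
      obtain c where c: "c \<ge> 0" and le: "\<And>n s t. s \<in> {0<..<T} \<Longrightarrow> t \<in> {0<..<T} \<Longrightarrow>
          norm (u n t - u n s) \<le> \<epsilon> * (sn (u n t) + sn (u n s)) + c * \<bar>V n t - V n s\<bar>"
        using ehr[OF \<epsilon>(1)] by blast
      define \<eta> where "\<eta> = e / (4 * (c + 1))"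
      have \<eta>: "\<eta> > 0" "c * (2 * \<eta>) \<le> e / 2"
        using e c by (auto simp: \<eta>_def field_simps)
      obtain l where l: "l > 0" and V_le: "\<And>n s t. s \<in> {0<..<T} \<Longrightarrow> t \<in> {0<..<T} \<Longrightarrow> s \<le> t \<Longrightarrow>
          V n t - V n s \<le> l * (t - s + \<tau> n) + \<eta>"
        using modulus[OF \<eta>(1)] by blast
      \<comment> \<open>One \<open>\<delta>\<close> bounds t - s and the other the step
        \<open>\<tau> n\<close>, so the linear part of the modulus is at most \<open>\<eta>\<close>
        and the whole at most 2 \<open>\<eta>\<close>.\<close>
      define \<delta> where "\<delta> = \<eta> / (2 * l)"
      have \<delta>: "\<delta> > 0" "l * (\<delta> + \<delta>) = \<eta>"
        using \<eta> l by (auto simp: \<delta>_def)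
      obtain n0 where n0: "\<And>n. n \<ge> n0 \<Longrightarrow> \<tau> n < \<delta>"
        using order_tendstoD(2)[OF \<tau>_0 \<delta>(1)] by (auto simp: eventually_sequentially)
      have "norm (u n t - u n s) \<le> e"
        if n: "n \<ge> n0" and st: "s \<in> {0<..<T}" "t \<in> {0<..<T}" "s \<le> t" "t - s < \<delta>" for n s t
      proof -
        have "l * (t - s + \<tau> n) \<le> l * (\<delta> + \<delta>)"
          using n0[OF n] st l by (intro mult_left_mono) auto
        then have "\<bar>V n t - V n s\<bar> \<le> 2 * \<eta>"
          using V_le[OF st(1-3), of n] monoD[OF V_mono st(3), of n] \<delta>(2) by simp
        then have "c * \<bar>V n t - V n s\<bar> \<le> c * (2 * \<eta>)"
          using c by (rule mult_left_mono)
        moreover have "\<epsilon> * (sn (u n t) + sn (u n s)) \<le> \<epsilon> * (K + K)"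
          using sn_le[OF st(1), of n] sn_le[OF st(2), of n] \<epsilon>(1) by (intro mult_left_mono) auto
        ultimately show ?thesis
          using le[OF st(1,2), of n] \<epsilon>(2) \<eta>(2) by (simp add: algebra_simps)
      qed
      then show ?thesis
        using \<delta>(1) by blast
    qed
    have cpt: "\<exists>s'. strict_mono (s' :: nat \<Rightarrow> nat) \<and> convergent (\<lambda>n. u (s (s' n)) t)"
      if t: "t \<in> {0<..<T}" for t and s :: "nat \<Rightarrow> nat"
    proof -
      obtain s' where "strict_mono (s' :: nat \<Rightarrow> nat)" "convergent (\<lambda>n. u (s (s' n)) t)"
        by (rule compactly_embeddedD[OF i, of "\<lambda>n. u (s n) t" K]) (use M sn_le t in auto)
      then show ?thesis by blast
    qed
    have "\<exists>s f. strict_mono (s :: nat \<Rightarrow> nat) \<and> continuous_on {0..T} f \<and>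
        (\<forall>t\<in>{0<..<T}. (\<lambda>n. u (s n) t) \<longlonglongrightarrow> f t)"
      by (rule equicontinuous_subseq_tendsto[OF T]) (rule cpt, assumption, rule equi)
    then obtain s f where s: "strict_mono (s :: nat \<Rightarrow> nat)" and f: "continuous_on {0..T} f"
      and lim: "\<And>t. t \<in> {0<..<T} \<Longrightarrow> (\<lambda>n. u (s n) t) \<longlonglongrightarrow> f t"
      by blast
    obtain B where B: "\<And>x. x \<in> M \<Longrightarrow> sn x \<le> K \<Longrightarrow> norm x \<le> B"
      using compactly_embedded_bounded[OF i, of K] by blast
    have "Lp_converges q T (\<lambda>n. u (s n)) f" if "1 \<le> q" "q < \<infinity>" for q
      using that by (intro Lp_converges_bounded_pointwise[OF T, of _ _ B]) (auto simp: simple B M sn_le lim)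
    then show ?thesis
      using s f by blast
  qed
  show ?thesis
    using finite_case infinite_case by blast
qed

end
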